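(* We have $\iota_\#\pi_1(\mathbb{E},\ast)\leqslant\pi^s(\mathbb{T},\ast)$, where $\iota:(\mathbb{E},\ast)\to(\mathbb{T},\ast)$ is the inclusion and $\pi^s(\mathbb{T},\ast)$ is the Spanier group of $\mathbb{T}$ at $\ast$. In particular, $\pi^s(\mathbb{T},\ast)$ is uncountable.
   Context: For each $m\in\mathbb{N}=\{1,2,3,\dots\}$ let $C_m\subseteq\mathbb{R}^2$ be the circle of radius $\frac1m$ centered at $(\frac1m,0)$; let $\mathbb{E}=\bigcup_{m\in\mathbb{N}}C_m\subseteq\mathbb{R}^2$ (subspace topology) with basepoint $\ast=(0,0)$. Let $\ell_m:[0,1]\to C_m$ be the loop $\ell_m(t)=\left(\frac1m(1-\cos 2\pi t),\frac1m\sin 2\pi t\right)$. Let $f:\mathbb{E}\to\mathbb{E}$ be the unique continuous map with $f\circ\ell_m=\ell_{m+1}$ for all $m\in\mathbb{N}$. Let $\mathbb{T}$ be the mapping torus of $f$, i.e. the quotient space $\mathbb{E}\times[0,1]/\sim$ with $(x,1)\sim(f(x),0)$ for all $x\in\mathbb{E}$, and let $h:\mathbb{E}\times[0,1]\to\mathbb{T}$ be the quotient map. Identify $\mathbb{E}$ with $h(\mathbb{E}\times\{0\})\subseteq\mathbb{T}$ via $x\mapsto h(x,0)$, and let $\iota:(\mathbb{E},\ast)\to(\mathbb{T},\ast)$ denote the inclusion. Spanier group: for a space $X$ with $x\in X$ and an open cover $\mathcal{U}$ of $X$, let $\pi(\mathcal{U},x)$ be the subgroup of $\pi_1(X,x)$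 generated by all elements $[\gamma\cdot\delta\cdot\gamma^-]$ where $\gamma:[0,1]\to X$ is a path with $\gamma(0)=x$, $\gamma^-(t)=\gamma(1-t)$, and $\delta$ is a loop based at $\gamma(1)$ whose image lies in some $U\in\mathcal{U}$. The Spanier group is $\pi^s(X,x)=\bigcap_{\mathcal{U}}\pi(\mathcal{U},x)$, the intersection over all open covers $\mathcal{U}$ of $X$. *)

theory Defs
  imports "HOL-Analysis.Analysis" "HOL-Algebra.Generated_Groups"
begin

section \<open>Paths and the fundamental group of an abstract topological space\<close>

text \<open>
  The library's \<^term>\<open>joinpaths\<close>, \<^term>\<open>reversepath\<close> and \<^term>\<open>homotopic_paths\<close> require the points to
  form a type of class \<^class>\<open>topological_space\<close>; a quotient space is only available as an
  \<open>'a topology\<close>, so the same notions are given here for \<^term>\<open>pathin\<close>.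
\<close>

definition path_concat :: "(real \<Rightarrow> 'a) \<Rightarrow> (real \<Rightarrow> 'a) \<Rightarrow> real \<Rightarrow> 'a"  (infixl \<open>\<cdot>\<^sub>p\<close> 75) where
  "p \<cdot>\<^sub>p q = (\<lambda>t. if t \<le> 1/2 then p (2 * t) else q (2 * t - 1))"

definition path_rev :: "(real \<Rightarrow> 'a) \<Rightarrow> real \<Rightarrow> 'a" where
  "path_rev p = (\<lambda>t. p (1 - t))"

definition path_homotopic :: "'a topology \<Rightarrow> (real \<Rightarrow> 'a) \<Rightarrow> (real \<Rightarrow> 'a) \<Rightarrow> bool" where
  "path_homotopic X p q \<longleftrightarrow>
     homotopic_with (\<lambda>r. r 0 = p 0 \<and> r 1 = p 1) (top_of_set {0..1}) X p q"

definition path_class :: "'a topology \<Rightarrow> (real \<Rightarrow> 'a) \<Rightarrow> (real \<Rightarrow> 'a) set" where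
  "path_class X p = {q. path_homotopic X p q}"

definition loops_at :: "'a topology \<Rightarrow> 'a \<Rightarrow> (real \<Rightarrow> 'a) set" where
  "loops_at X x = {p. pathin X p \<and> p 0 = x \<and> p 1 = x}"

definition fundamental_group :: "'a topology \<Rightarrow> 'a \<Rightarrow> (real \<Rightarrow> 'a) set monoid" where
  "fundamental_group X x =
     \<lparr> carrier = path_class X ` loops_at X x,
       mult = (\<lambda>A B. \<Union>p\<in>A. \<Union>q\<in>B. path_class X (p \<cdot>\<^sub>p q)),
       one = path_class X (\<lambda>t. x) \<rparr>"

definition induced_map :: "'b topology \<Rightarrow> ('a \<Rightarrow> 'b) \<Rightarrow> (real \<Rightarrow> 'a) set \<Rightarrow> (real \<Rightarrow> 'b) set" where
  "induced_map Y f A = (\<Union>p\<in>A. path_class Y (f \<circ> p))"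


section \<open>The Spanier group\<close>

definition open_cover :: "'a topology \<Rightarrow> 'a set set \<Rightarrow> bool" where
  "open_cover X \<U> \<longleftrightarrow> (\<forall>U\<in>\<U>. openin X U) \<and> topspace X \<subseteq> \<Union>\<U>"

definition spanier_cover :: "'a topology \<Rightarrow> 'a set set \<Rightarrow> 'a \<Rightarrow> (real \<Rightarrow> 'a) set set" where
  "spanier_cover X \<U> x =
     generate (fundamental_group X x)
       {path_class X (\<gamma> \<cdot>\<^sub>p \<delta> \<cdot>\<^sub>p path_rev \<gamma>) |\<gamma> \<delta>.
          pathin X \<gamma> \<and> \<gamma> 0 = x \<and> \<delta> \<in> loops_at X (\<gamma> 1) \<and> (\<exists>U\<in>\<U>. \<delta> ` {0..1} \<subseteq> U)}"

definition spanier_group :: "'a topology \<Rightarrow> 'a \<Rightarrow> (real \<Rightarrow> 'a) set set" where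
  "spanier_group X x = (\<Inter>\<U>\<in>{\<U>. open_cover X \<U>}. spanier_cover X \<U> x)"


section \<open>The mapping torus\<close>

definition quotient_topology :: "'a topology \<Rightarrow> ('a \<Rightarrow> 'b) \<Rightarrow> 'b topology" where
  "quotient_topology X h =
     topology (\<lambda>V. V \<subseteq> h ` topspace X \<and> openin X {x \<in> topspace X. h x \<in> V})"

definition torus_rel :: "'a topology \<Rightarrow> ('a \<Rightarrow> 'a) \<Rightarrow> (('a \<times> real) \<times> ('a \<times> real)) set" where
  "torus_rel X f =
     (let R = {((x, 1), (f x, 0)) |x. x \<in> topspace X} in (R \<union> R\<inverse>)\<^sup>*)"

definition torus_proj :: "'a topology \<Rightarrow> ('a \<Rightarrow> 'a) \<Rightarrow> 'a \<times> real \<Rightarrow> ('a \<times> real) set" where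
  "torus_proj X f z = torus_rel X f `` {z}"

definition mapping_torus :: "'a topology \<Rightarrow> ('a \<Rightarrow> 'a) \<Rightarrow> ('a \<times> real) set topology" where
  "mapping_torus X f =
     quotient_topology (prod_topology X (top_of_set {0..1})) (torus_proj X f)"


section \<open>The Hawaiian earring and its mapping torus\<close>

definition earring_circle :: "nat \<Rightarrow> (real \<times> real) set" where
  "earring_circle m = sphere (1 / real m, 0) (1 / real m)"

definition earring_set :: "(real \<times> real) set" where
  "earring_set = (\<Union>m\<in>{1..}. earring_circle m)"

definition earring :: "(real \<times> real) topology" where
  "earring = top_of_set earring_set"

definition earring_loop :: "nat \<Rightarrow> real \<Rightarrow> real \<times> real" where
  "earring_loop m t = (1 / real m * (1 - cos (2 * pi * t)), 1 / real m * sin (2 * pi * t))"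

text \<open>
  Functions are total in HOL, so uniqueness of the shift map holds among extensional functions, which take a
  fixed default value outside \<^term>\<open>earring_set\<close>.
\<close>

definition is_earring_shift :: "(real \<times> real \<Rightarrow> real \<times> real) \<Rightarrow> bool" where
  "is_earring_shift f \<longleftrightarrow>
     f \<in> extensional earring_set \<and> continuous_map earring earring f \<and>
     (\<forall>m\<ge>1. \<forall>t\<in>{0..1}. f (earring_loop m t) = earring_loop (m + 1) t)"

definition earring_shift :: "real \<times> real \<Rightarrow> real \<times> real" where
  "earring_shift = (THE f. is_earring_shift f)"

definition earring_torus :: "((real \<times> real) \<times> real) set topology" where
  "earring_torus = mapping_torus earring earring_shift"

definition earring_incl :: "real \<times> real \<Rightarrow> ((real \<times> real) \<times> real) set" where
  "earring_incl x = torus_proj earring earring_shift (x, 0)"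


section \<open>The fundamental group is a group and the Spanier group is a subgroup\<close>

lemma path_homotopic_imp:
  assumes "path_homotopic X p q"
  shows "pathin X p" "pathin X q" "q 0 = p 0" "q 1 = p 1"
  using homotopic_with_imp_continuous_maps[of _ "top_of_set {0..1}" X p q]
    homotopic_with_imp_property[of _ "top_of_set {0..1}" X p q] assms
  unfolding path_homotopic_def pathin_def by blast+

lemma path_homotopic_refl [simp]: "path_homotopic X p p \<longleftrightarrow> pathin X p"
  by (simp add: path_homotopic_def pathin_def)

lemma path_homotopic_sym:
  assumes "path_homotopic X p q"
  shows "path_homotopic X q p"
  using assms homotopic_with_symD path_homotopic_imp(3,4)[OF assms]
  unfolding path_homotopic_def by fastforce

lemma path_homotopic_trans:
  assumes "path_homotopic X p q" "path_homotopic X q r"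
  shows "path_homotopic X p r"
  using assms homotopic_with_trans path_homotopic_imp(3,4)[OF assms(1)]
  unfolding path_homotopic_def by fastforce

lemma path_homotopic_eq:
  assumes "pathin X p" "\<And>t. t \<in> {0..1} \<Longrightarrow> p t = q t"
  shows "path_homotopic X p q"
  unfolding path_homotopic_def
  by (rule homotopic_with_equal) (use assms in \<open>auto simp: pathin_def\<close>)

lemma path_homotopic_compose:
  assumes "path_homotopic X p q" "continuous_map X Y f"
  shows "path_homotopic Y (f \<circ> p) (f \<circ> q)"
  using assms unfolding path_homotopic_def
  by (auto intro: homotopic_with_compose_continuous_map_left)

lemma path_homotopic_reparam:
  assumes p: "pathin X p"
    and \<phi>: "continuous_on {0..1} \<phi>" "\<phi> \<in> {0..1} \<rightarrow> {0..1}"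
    and \<psi>: "continuous_on {0..1} \<psi>" "\<psi> \<in> {0..1} \<rightarrow> {0..1}"
    and ends: "\<phi> 0 = \<psi> 0" "\<phi> 1 = \<psi> 1"
  shows "path_homotopic X (p \<circ> \<phi>) (p \<circ> \<psi>)"
proof (rule path_homotopic_compose)
  show "path_homotopic (top_of_set {0..1}) \<phi> \<psi>"
    unfolding path_homotopic_def homotopic_with_def
  proof (intro exI conjI allI ballI)
    let ?h = "\<lambda>z. (1 - fst z) * \<phi> (snd z) + fst z * \<psi> (snd z)"
    have "continuous_on ({0..1} \<times> {0..1}) ?h"
      by (intro continuous_intros continuous_on_compose2[OF \<phi>(1)] continuous_on_compose2[OF \<psi>(1)]) auto
    moreover have "?h z \<in> {0..1}" if "z \<in> {0..1} \<times> {0..1}" for z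
    proof -
      have "\<phi> (snd z) \<in> {0..1}" "\<psi> (snd z) \<in> {0..1}" "fst z \<in> {0..1}"
        using that \<phi>(2) \<psi>(2) by auto
      then show ?thesis
        using convex_bound_le[of "\<phi> (snd z)" 1 "\<psi> (snd z)" "1 - fst z" "fst z"] by auto
    qed
    ultimately show "continuous_map (prod_topology (top_of_set {0..1}) (top_of_set {0..1})) (top_of_set {0..1}) ?h"
      by (auto simp: continuous_map_in_subtopology)
  qed (use ends in \<open>auto simp: algebra_simps\<close>)
  show "continuous_map (top_of_set {0..1}) X p"
    using p by (simp add: pathin_def)
qed

lemma path_homotopic_concat:
  assumes p: "path_homotopic X p p'" and q: "path_homotopic X q q'" and pq: "p 1 = q 0"
  shows "path_homotopic X (p \<cdot>\<^sub>p q) (p' \<cdot>\<^sub>p q')"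
proof -
  let ?I = "top_of_set {0..1::real}"
  let ?II = "prod_topology ?I ?I"
  obtain h where h: "continuous_map ?II X h" "\<And>t. h (0, t) = p t" "\<And>t. h (1, t) = p' t"
    "\<And>s. s \<in> {0..1} \<Longrightarrow> h (s, 0) = p 0 \<and> h (s, 1) = p 1"
    using p unfolding path_homotopic_def homotopic_with_def by blast
  obtain k where k: "continuous_map ?II X k" "\<And>t. k (0, t) = q t" "\<And>t. k (1, t) = q' t"
    "\<And>s. s \<in> {0..1} \<Longrightarrow> k (s, 0) = q 0 \<and> k (s, 1) = q 1"
    using q unfolding path_homotopic_def homotopic_with_def by blast
  have fst: "continuous_map ?II ?I fst" and snd: "continuous_map ?II ?I snd"
    by (rule continuous_map_fst continuous_map_snd)+
  define H where "H = (\<lambda>z. if snd z \<le> 1/2 then (h \<circ> (\<lambda>z. (fst z, 2 * snd z))) z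
                            else (k \<circ> (\<lambda>z. (fst z, 2 * snd z - 1))) z)"
  have "continuous_map ?II X H"
    unfolding H_def
  proof (rule continuous_map_cases_le)
    show "continuous_map ?II euclideanreal snd"
      using snd by (simp add: continuous_map_in_subtopology)
    show "continuous_map (subtopology ?II {z \<in> topspace ?II. snd z \<le> 1/2}) X
            (h \<circ> (\<lambda>z. (fst z, 2 * snd z)))"
      by (rule continuous_map_compose[OF _ h(1)])
        (auto simp: subtopology_subtopology continuous_map_in_subtopology
           intro!: continuous_intros)
    show "continuous_map (subtopology ?II {z \<in> topspace ?II. 1/2 \<le> snd z}) X
            (k \<circ> (\<lambda>z. (fst z, 2 * snd z - 1)))"
      by (rule continuous_map_compose[OF _ k(1)])
        (auto simp: subtopology_subtopology continuous_map_in_subtopology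
           intro!: continuous_intros)
    show "(h \<circ> (\<lambda>z. (fst z, 2 * snd z))) z = (k \<circ> (\<lambda>z. (fst z, 2 * snd z - 1))) z"
      if "z \<in> topspace ?II" "snd z = 1/2" for z
    proof -
      have "fst z \<in> {0..1}" using that(1) by auto
      moreover have "2 * snd z = 1" "2 * snd z - 1 = 0" using that(2) by simp_all
      ultimately show ?thesis using h(4) k(4) pq by (simp only: o_def)
    qed
  qed auto
  then show ?thesis
    unfolding path_homotopic_def homotopic_with_def
    by (intro exI[of _ H]) (use h(2-4) k(2-4) in \<open>auto simp: H_def path_concat_def\<close>)
qed

lemma pathin_concat:
  assumes "pathin X p" "pathin X q" "p 1 = q 0"
  shows "pathin X (p \<cdot>\<^sub>p q)"
  using path_homotopic_concat[of X p p q q] assms by simp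

lemma pathin_rev:
  assumes "pathin X p"
  shows "pathin X (path_rev p)"
proof -
  have "continuous_map (top_of_set {0..1}) (top_of_set {0..1}) (\<lambda>t::real. 1 - t)"
    by (auto simp: continuous_map_in_subtopology intro!: continuous_intros)
  from continuous_map_compose[OF this, of X p] show ?thesis
    using assms by (simp add: pathin_def path_rev_def o_def)
qed

lemma path_concat_ends [simp]: "(p \<cdot>\<^sub>p q) 0 = p 0" "(p \<cdot>\<^sub>p q) 1 = q 1"
  by (simp_all add: path_concat_def)

lemma path_rev_ends [simp]: "path_rev p 0 = p 1" "path_rev p 1 = p 0"
  by (simp_all add: path_rev_def)

lemma path_homotopic_assoc:
  assumes "pathin X p" "pathin X q" "pathin X r" "p 1 = q 0" "q 1 = r 0"
  shows "path_homotopic X (p \<cdot>\<^sub>p q \<cdot>\<^sub>p r) (p \<cdot>\<^sub>p (q \<cdot>\<^sub>p r))"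
proof -
  let ?s = "p \<cdot>\<^sub>p (q \<cdot>\<^sub>p r)"
  let ?\<phi> = "\<lambda>t::real. min (2 * t) (min (t + 1/4) ((t + 1) / 2))"
  have s: "pathin X ?s" using assms by (simp add: pathin_concat)
  have 1: "path_homotopic X (?s \<circ> ?\<phi>) (?s \<circ> (\<lambda>t. t))"
    by (rule path_homotopic_reparam[OF s]) (auto simp: min_le_iff_disj intro!: continuous_intros)
  have 2: "path_homotopic X (p \<cdot>\<^sub>p q \<cdot>\<^sub>p r) (?s \<circ> ?\<phi>)"
  proof (rule path_homotopic_eq)
    show "pathin X (p \<cdot>\<^sub>p q \<cdot>\<^sub>p r)" using assms by (simp add: pathin_concat)
    fix t :: real assume "t \<in> {0..1}"
    then consider "t \<le> 1/4" | "1/4 < t" "t \<le> 1/2" | "1/2 < t" by linarith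
    then show "(p \<cdot>\<^sub>p q \<cdot>\<^sub>p r) t = (?s \<circ> ?\<phi>) t"
      by cases (auto simp: path_concat_def min_def algebra_simps add_divide_distrib diff_divide_distrib)
  qed
  show ?thesis using path_homotopic_trans[OF 2 1] by (simp only: o_def)
qed

lemma path_homotopic_const_concat:
  assumes "pathin X p"
  shows "path_homotopic X ((\<lambda>t. p 0) \<cdot>\<^sub>p p) p"
proof -
  have "path_homotopic X (p \<circ> (\<lambda>t. max 0 (2 * t - 1))) (p \<circ> (\<lambda>t. t))"
    by (rule path_homotopic_reparam[OF assms]) (auto intro!: continuous_intros)
  moreover have "p \<circ> (\<lambda>t. max 0 (2 * t - 1)) = (\<lambda>t. p 0) \<cdot>\<^sub>p p"
  proof
    fix t :: real
    show "(p \<circ> (\<lambda>t. max 0 (2 * t - 1))) t = ((\<lambda>t. p 0) \<cdot>\<^sub>p p) t"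
      by (cases "t \<le> 1/2") (simp_all add: path_concat_def max_absorb1 max_absorb2)
  qed
  ultimately show ?thesis by (simp add: o_def)
qed

lemma path_homotopic_rev_concat:
  assumes "pathin X p"
  shows "path_homotopic X (path_rev p \<cdot>\<^sub>p p) (\<lambda>t. p 1)"
proof -
  have "path_homotopic X (p \<circ> (\<lambda>t. \<bar>2 * t - 1\<bar>)) (p \<circ> (\<lambda>t. 1))"
    by (rule path_homotopic_reparam[OF assms]) (auto intro!: continuous_intros)
  moreover have "p \<circ> (\<lambda>t. \<bar>2 * t - 1\<bar>) = path_rev p \<cdot>\<^sub>p p"
  proof
    fix t :: real
    show "(p \<circ> (\<lambda>t. \<bar>2 * t - 1\<bar>)) t = (path_rev p \<cdot>\<^sub>p p) t"
      by (cases "t \<le> 1/2") (simp_all add: path_concat_def path_rev_def)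
  qed
  ultimately show ?thesis by (simp add: o_def)
qed

lemma path_class_eq_iff:
  assumes "pathin X p"
  shows "path_class X p = path_class X q \<longleftrightarrow> path_homotopic X p q"
proof
  assume "path_class X p = path_class X q"
  then have "path_homotopic X q p" using assms by (auto simp: path_class_def)
  then show "path_homotopic X p q" by (rule path_homotopic_sym)
qed (auto simp: path_class_def intro: path_homotopic_trans path_homotopic_sym)

lemma fundamental_group_mult:
  assumes "p \<in> loops_at X x" "q \<in> loops_at X x"
  shows "path_class X p \<otimes>\<^bsub>fundamental_group X x\<^esub> path_class X q = path_class X (p \<cdot>\<^sub>p q)"
proof -
  have "path_class X (p' \<cdot>\<^sub>p q') = path_class X (p \<cdot>\<^sub>p q)"
    if "p' \<in> path_class X p" "q' \<in> path_class X q" for p' q'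
  proof -
    have "path_homotopic X (p \<cdot>\<^sub>p q) (p' \<cdot>\<^sub>p q')"
      using that assms by (intro path_homotopic_concat) (auto simp: path_class_def loops_at_def)
    then show ?thesis by (metis path_class_eq_iff path_homotopic_imp(1))
  qed
  then have "(\<Union>p'\<in>path_class X p. \<Union>q'\<in>path_class X q. path_class X (p' \<cdot>\<^sub>p q'))
      = (\<Union>p'\<in>path_class X p. \<Union>q'\<in>path_class X q. path_class X (p \<cdot>\<^sub>p q))"
    by (intro SUP_cong refl)
  also have "\<dots> = path_class X (p \<cdot>\<^sub>p q)"
  proof -
    have "path_class X p \<noteq> {}" "path_class X q \<noteq> {}"
      using assms by (auto simp: path_class_def loops_at_def intro: path_homotopic_refl[THEN iffD2])
    then show ?thesis by simp
  qed
  finally have "(\<Union>p'\<in>path_class X p. \<Union>q'\<in>path_class X q. path_class X (p' \<cdot>\<^sub>p q'))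
      = path_class X (p \<cdot>\<^sub>p q)" .
  then show ?thesis unfolding fundamental_group_def monoid.simps .
qed

lemma loops_at_concat:
  assumes "p \<in> loops_at X x" "q \<in> loops_at X x"
  shows "p \<cdot>\<^sub>p q \<in> loops_at X x"
  using assms by (simp add: loops_at_def pathin_concat)

lemma const_loops_at: "x \<in> topspace X \<Longrightarrow> (\<lambda>t. x) \<in> loops_at X x"
  by (simp add: loops_at_def pathin_def)

lemma carrier_fundamental_group: "carrier (fundamental_group X x) = path_class X ` loops_at X x"
  by (simp add: fundamental_group_def)

lemma group_fundamental_group:
  assumes x: "x \<in> topspace X"
  shows "group (fundamental_group X x)"
proof (rule groupI)
  fix a b assume "a \<in> carrier (fundamental_group X x)" "b \<in> carrier (fundamental_group X x)"
  then show "a \<otimes>\<^bsub>fundamental_group X x\<^esub> b \<in> carrier (fundamental_group X x)"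
    by (auto simp: carrier_fundamental_group fundamental_group_mult loops_at_concat)
next
  have one: "\<one>\<^bsub>fundamental_group X x\<^esub> = path_class X (\<lambda>t. x)"
    by (simp add: fundamental_group_def)
  show "\<one>\<^bsub>fundamental_group X x\<^esub> \<in> carrier (fundamental_group X x)"
    using const_loops_at[OF x] by (auto simp: carrier_fundamental_group one)
  fix a assume "a \<in> carrier (fundamental_group X x)"
  then obtain p where p: "p \<in> loops_at X x" "a = path_class X p"
    by (auto simp: carrier_fundamental_group)
  then have p': "pathin X p" "p 0 = x" "p 1 = x" by (auto simp: loops_at_def)
  show "\<one>\<^bsub>fundamental_group X x\<^esub> \<otimes>\<^bsub>fundamental_group X x\<^esub> a = a"
    unfolding one p(2) fundamental_group_mult[OF const_loops_at[OF x] p(1)]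
    using path_homotopic_const_concat[OF p'(1)] p'(2)
    by (metis path_class_eq_iff path_homotopic_imp(1))
  have r: "path_rev p \<in> loops_at X x"
    using p' by (simp add: loops_at_def pathin_rev)
  have "path_class X (path_rev p) \<otimes>\<^bsub>fundamental_group X x\<^esub> a = \<one>\<^bsub>fundamental_group X x\<^esub>"
    unfolding one p(2) fundamental_group_mult[OF r p(1)]
    using path_homotopic_rev_concat[OF p'(1)] p'(3)
    by (metis path_class_eq_iff path_homotopic_imp(1))
  then show "\<exists>b\<in>carrier (fundamental_group X x). b \<otimes>\<^bsub>fundamental_group X x\<^esub> a = \<one>\<^bsub>fundamental_group X x\<^esub>"
    using r by (auto simp: carrier_fundamental_group)
next
  fix a b c
  assume "a \<in> carrier (fundamental_group X x)" "b \<in> carrier (fundamental_group X x)"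
    "c \<in> carrier (fundamental_group X x)"
  then obtain p q r where pqr: "p \<in> loops_at X x" "q \<in> loops_at X x" "r \<in> loops_at X x"
    "a = path_class X p" "b = path_class X q" "c = path_class X r"
    by (auto simp: carrier_fundamental_group)
  have "path_homotopic X (p \<cdot>\<^sub>p q \<cdot>\<^sub>p r) (p \<cdot>\<^sub>p (q \<cdot>\<^sub>p r))"
    using pqr by (intro path_homotopic_assoc) (auto simp: loops_at_def)
  then have "path_class X (p \<cdot>\<^sub>p q \<cdot>\<^sub>p r) = path_class X (p \<cdot>\<^sub>p (q \<cdot>\<^sub>p r))"
    by (metis path_class_eq_iff path_homotopic_imp(1))
  then show "a \<otimes>\<^bsub>fundamental_group X x\<^esub> b \<otimes>\<^bsub>fundamental_group X x\<^esub> c =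
      a \<otimes>\<^bsub>fundamental_group X x\<^esub> (b \<otimes>\<^bsub>fundamental_group X x\<^esub> c)"
    unfolding pqr(4-6)
    by (simp only: fundamental_group_mult pqr(1-3) loops_at_concat)
qed

lemma induced_map_path_class:
  assumes f: "continuous_map X Y f" and p: "pathin X p"
  shows "induced_map Y f (path_class X p) = path_class Y (f \<circ> p)"
proof -
  have "path_class Y (f \<circ> q) = path_class Y (f \<circ> p)" if "q \<in> path_class X p" for q
    using path_homotopic_compose[OF _ f, of p q] that
    by (metis mem_Collect_eq path_class_def path_class_eq_iff path_homotopic_imp(1))
  then have "induced_map Y f (path_class X p) = (\<Union>q\<in>path_class X p. path_class Y (f \<circ> p))"
    unfolding induced_map_def by (rule SUP_cong[OF refl])
  moreover have "path_class X p \<noteq> {}"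
    using p by (auto simp: path_class_def intro: path_homotopic_refl[THEN iffD2])
  ultimately show ?thesis by simp
qed

lemma induced_map_hom:
  assumes f: "continuous_map X Y f"
  shows "induced_map Y f \<in> hom (fundamental_group X x) (fundamental_group Y (f x))"
proof (rule homI)
  have l: "f \<circ> p \<in> loops_at Y (f x)" if "p \<in> loops_at X x" for p
    using that pathin_compose[OF _ f] by (auto simp: loops_at_def)
  have i: "induced_map Y f (path_class X p) = path_class Y (f \<circ> p)" if "p \<in> loops_at X x" for p
    using that induced_map_path_class[OF f] by (auto simp: loops_at_def)
  have c: "f \<circ> p \<cdot>\<^sub>p q = (f \<circ> p) \<cdot>\<^sub>p (f \<circ> q)" for p q
    by (auto simp: path_concat_def)
  fix a assume "a \<in> carrier (fundamental_group X x)"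
  then obtain p where p: "p \<in> loops_at X x" "a = path_class X p"
    by (auto simp: carrier_fundamental_group)
  then show "induced_map Y f a \<in> carrier (fundamental_group Y (f x))"
    by (simp add: i l carrier_fundamental_group)
  fix b assume "b \<in> carrier (fundamental_group X x)"
  then obtain q where q: "q \<in> loops_at X x" "b = path_class X q"
    by (auto simp: carrier_fundamental_group)
  show "induced_map Y f (a \<otimes>\<^bsub>fundamental_group X x\<^esub> b) =
      induced_map Y f a \<otimes>\<^bsub>fundamental_group Y (f x)\<^esub> induced_map Y f b"
    using p q by (simp add: fundamental_group_mult i l c loops_at_concat)
qed

lemma subgroup_spanier_group:
  assumes x: "x \<in> topspace X"
  shows "subgroup (spanier_group X x) (fundamental_group X x)"
  unfolding spanier_group_def
proof (rule group.subgroups_Inter[OF group_fundamental_group[OF x]])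
  have "open_cover X {topspace X}" by (simp add: open_cover_def)
  then show "(\<lambda>\<U>. spanier_cover X \<U> x) ` {\<U>. open_cover X \<U>} \<noteq> {}" by blast
  fix H assume "H \<in> (\<lambda>\<U>. spanier_cover X \<U> x) ` {\<U>. open_cover X \<U>}"
  then obtain \<U> where H: "H = spanier_cover X \<U> x" by blast
  have "path_class X (\<gamma> \<cdot>\<^sub>p \<delta> \<cdot>\<^sub>p path_rev \<gamma>) \<in> carrier (fundamental_group X x)"
    if "pathin X \<gamma>" "\<gamma> 0 = x" "\<delta> \<in> loops_at X (\<gamma> 1)" for \<gamma> \<delta>
    unfolding carrier_fundamental_group
    by (rule imageI) (use that in \<open>simp add: loops_at_def pathin_concat pathin_rev\<close>)
  then show "subgroup H (fundamental_group X x)"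
    unfolding H spanier_cover_def
    by (intro group.generate_is_subgroup[OF group_fundamental_group[OF x]]) blast
qed

section \<open>The mapping torus and the shift map are well defined\<close>

lemma istopology_quotient:
  fixes h :: "'a \<Rightarrow> 'b"
  shows "istopology (\<lambda>V. V \<subseteq> h ` topspace X \<and> openin X {x \<in> topspace X. h x \<in> V})"
  unfolding istopology_def
proof (intro conjI allI impI; (elim conjE)?)
  fix S T assume "openin X {x \<in> topspace X. h x \<in> S}" "openin X {x \<in> topspace X. h x \<in> T}"
  then have "openin X ({x \<in> topspace X. h x \<in> S} \<inter> {x \<in> topspace X. h x \<in> T})"
    by (rule openin_Int)
  also have "{x \<in> topspace X. h x \<in> S} \<inter> {x \<in> topspace X. h x \<in> T} = {x \<in> topspace X. h x \<in> S \<inter> T}"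
    by auto
  finally show "openin X {x \<in> topspace X. h x \<in> S \<inter> T}" .
next
  fix \<K> assume "\<forall>K\<in>\<K>. K \<subseteq> h ` topspace X \<and> openin X {x \<in> topspace X. h x \<in> K}"
  then have "openin X (\<Union>K\<in>\<K>. {x \<in> topspace X. h x \<in> K})"
    by (intro openin_Union) auto
  also have "(\<Union>K\<in>\<K>. {x \<in> topspace X. h x \<in> K}) = {x \<in> topspace X. h x \<in> \<Union>\<K>}"
    by auto
  finally show "openin X {x \<in> topspace X. h x \<in> \<Union>\<K>}" .
next
  fix S T :: "'b set" assume "S \<subseteq> h ` topspace X"
  then show "S \<inter> T \<subseteq> h ` topspace X" by (rule le_infI1)
next
  fix \<K> :: "'b set set" assume "\<forall>K\<in>\<K>. K \<subseteq> h ` topspace X \<and> openin X {x \<in> topspace X. h x \<in> K}"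
  then show "\<Union>\<K> \<subseteq> h ` topspace X" by (intro Union_least) blast
qed

lemma openin_quotient_topology:
  "openin (quotient_topology X h) V \<longleftrightarrow>
     V \<subseteq> h ` topspace X \<and> openin X {x \<in> topspace X. h x \<in> V}"
  unfolding quotient_topology_def by (simp add: topology_inverse'[OF istopology_quotient])

lemma topspace_quotient_topology [simp]: "topspace (quotient_topology X h) = h ` topspace X"
proof (rule antisym)
  show "topspace (quotient_topology X h) \<subseteq> h ` topspace X"
    by (rule openin_quotient_topology[THEN iffD1, OF openin_topspace, THEN conjunct1])
  have "{x \<in> topspace X. h x \<in> h ` topspace X} = topspace X" by auto
  then have "openin (quotient_topology X h) (h ` topspace X)"
    by (simp add: openin_quotient_topology)
  then show "h ` topspace X \<subseteq> topspace (quotient_topology X h)"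
    by (rule openin_subset)
qed

lemma quotient_map_quotient_topology: "quotient_map X (quotient_topology X h) h"
  unfolding quotient_map_def by (auto simp: openin_quotient_topology)

lemma quotient_map_torus_proj:
  "quotient_map (prod_topology X (top_of_set {0..1})) (mapping_torus X f) (torus_proj X f)"
  unfolding mapping_torus_def by (rule quotient_map_quotient_topology)

lemma equiv_torus_rel: "equiv UNIV (torus_rel X f)"
  unfolding torus_rel_def Let_def
  by (intro equivI refl_rtrancl trans_rtrancl sym_rtrancl sym_Un_converse) auto

lemma earring_circle_eq: 
  assumes "m \<ge> 1"
  shows "earring_circle m = earring_loop m ` {0..1}"
proof (intro subset_antisym subsetI)
  have m: "real m > 0" using assms by simp
  fix z assume "z \<in> earring_circle m"
  obtain a b where z: "z = (a, b)" by (cases z)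
  have "sqrt ((1 / real m - a)\<^sup>2 + b\<^sup>2) = 1 / real m"
    using \<open>z \<in> _\<close> by (simp add: z earring_circle_def dist_prod_def dist_real_def)
  then have "(1 / real m - a)\<^sup>2 + b\<^sup>2 = (1 / real m)\<^sup>2"
    by (metis real_sqrt_pow2 sum_power2_ge_zero)
  then have "(real m)\<^sup>2 * ((1 / real m - a)\<^sup>2 + b\<^sup>2) = 1"
    using m by (simp add: power_divide)
  moreover have "(real m)\<^sup>2 * ((1 / real m - a)\<^sup>2 + b\<^sup>2) = (1 - real m * a)\<^sup>2 + (real m * b)\<^sup>2"
    using m by (simp add: power2_eq_square field_simps)
  ultimately have "(1 - real m * a)\<^sup>2 + (real m * b)\<^sup>2 = 1" by simp
  then obtain t where t: "0 \<le> t" "t < 2 * pi" "1 - real m * a = cos t" "real m * b = sin t"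
    using sincos_total_2pi by metis
  then have "z = earring_loop m (t / (2 * pi))"
    using m by (simp add: z earring_loop_def field_simps)
  moreover have "t / (2 * pi) \<in> {0..1}" using t by (simp add: field_simps)
  ultimately show "z \<in> earring_loop m ` {0..1}" by blast
next
  have m: "real m > 0" using assms by simp
  fix z assume "z \<in> earring_loop m ` {0..1}"
  then obtain t where z: "z = earring_loop m t" by blast
  define c s where "c = cos (2 * pi * t)" and "s = sin (2 * pi * t)"
  have "c\<^sup>2 + s\<^sup>2 = 1" by (simp add: c_def s_def)
  moreover have "(1 / real m - 1 / real m * (1 - c))\<^sup>2 + (1 / real m * s)\<^sup>2 = (1 / real m)\<^sup>2 * (c\<^sup>2 + s\<^sup>2)"
    using m by (simp add: power2_eq_square field_simps)
  ultimately have "sqrt ((1 / real m - 1 / real m * (1 - c))\<^sup>2 + (1 / real m * s)\<^sup>2) = 1 / real m"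
    by simp
  then show "z \<in> earring_circle m"
    by (simp add: z earring_loop_def earring_circle_def dist_prod_def dist_real_def c_def s_def power_divide)
qed

lemma earring_set_eq: "earring_set = (\<Union>m\<in>{1..}. earring_loop m ` {0..1})"
  unfolding earring_set_def using earring_circle_eq by auto

lemma ex1_earring_shift: "\<exists>!f. is_earring_shift f"
proof (rule ex_ex1I)
  define F :: "real \<times> real \<Rightarrow> real \<times> real" where
    "F z = (2 * fst z / (2 * fst z + (norm z)\<^sup>2)) *\<^sub>R z" for z
  have F_loop: "F (earring_loop m t) = earring_loop (m + 1) t" if "m \<ge> 1" for m t
  proof -
    define c s where "c = cos (2 * pi * t)" and "s = sin (2 * pi * t)"
    define k where "k = real m"
    have k: "k > 0" using that by (simp add: k_def)
    have cs: "s * s = 1 - c * c" 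
      unfolding c_def s_def by (metis power2_eq_square sin_squared_eq)
    have L: "earring_loop m t = (1 / k * (1 - c), 1 / k * s)"
      by (simp add: earring_loop_def c_def s_def k_def)
    have L': "earring_loop (m + 1) t = (1 / (k + 1) * (1 - c), 1 / (k + 1) * s)"
      by (simp add: earring_loop_def c_def s_def k_def add.commute)
    have "(norm (earring_loop m t))\<^sup>2 = ((1 - c) * (1 - c) + s * s) / k\<^sup>2"
      by (simp add: L norm_prod_def power2_eq_square add_divide_distrib)
    also have "\<dots> = 2 * (1 - c) / k\<^sup>2"
      unfolding cs by (simp add: algebra_simps)
    finally have n: "(norm (earring_loop m t))\<^sup>2 = 2 * (1 - c) / k\<^sup>2" .
    show ?thesis
    proof (cases "c = 1")
      case True
      then have "s = 0" using cs by simp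
      then show ?thesis using True
        unfolding L L' by (simp add: F_def)
    next
      case False
      have eq: "2 * ((1 - c) / k) + 2 * (1 - c) / k\<^sup>2 = (1 - c) * (2 * (k + 1) / k\<^sup>2)"
        using k by (simp add: field_simps power2_eq_square)
      have "2 * fst (earring_loop m t) / (2 * fst (earring_loop m t) + (norm (earring_loop m t))\<^sup>2)
          = (2 * ((1 - c) / k)) / ((1 - c) * (2 * (k + 1) / k\<^sup>2))"
        unfolding n eq[symmetric] by (simp add: L)
      also have "\<dots> = (2 / k) / (2 * (k + 1) / k\<^sup>2)"
        using False by (simp add: divide_simps)
      also have "\<dots> = k / (k + 1)"
        using k by (simp add: field_simps power2_eq_square)
      finally have "F (earring_loop m t) = (k / (k + 1)) *\<^sub>R earring_loop m t"
        by (simp add: F_def)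
      then show ?thesis
        unfolding L L' using k by simp
    qed
  qed
  have nonneg: "fst z \<ge> 0" if "z \<in> earring_set" for z
    using that by (auto simp: earring_set_eq earring_loop_def)
  have "isCont F z \<or> continuous (at z within earring_set) F" if z: "z \<in> earring_set" for z
  proof (cases "z = 0")
    case False
    then have "2 * fst z + (norm z)\<^sup>2 > 0"
      using nonneg[OF z] by (simp add: add_nonneg_pos)
    then show ?thesis
      unfolding F_def by (intro disjI1 continuous_intros) auto
  next
    case True
    have "norm (F w) \<le> norm w" if "w \<in> earring_set" for w
    proof -
      have "0 \<le> fst w" by (rule nonneg[OF that])
      then have "\<bar>2 * fst w / (2 * fst w + (norm w)\<^sup>2)\<bar> \<le> 1"
        by (simp add: divide_le_eq_1 add_nonneg_nonneg add_nonneg_eq_0_iff less_le)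
      then show ?thesis
        unfolding F_def norm_scaleR by (rule mult_left_le_one_le[rotated 2]) simp_all
    qed
    then have "eventually (\<lambda>w. norm (F w) \<le> norm w) (at 0 within earring_set)"
      by (simp add: eventually_at_filter)
    moreover have "((\<lambda>w :: real \<times> real. norm w) \<longlongrightarrow> 0) (at 0 within earring_set)"
      by (rule tendsto_norm_zero) (rule tendsto_ident_at)
    ultimately have "(F \<longlongrightarrow> 0) (at 0 within earring_set)"
      by (rule Lim_null_comparison)
    then show ?thesis
      by (simp add: True continuous_within F_def)
  qed
  then have "continuous_on earring_set F"
    unfolding continuous_on_eq_continuous_within by (meson continuous_at_imp_continuous_at_within)
  moreover have "F ` earring_set \<subseteq> earring_set"
  proof
    fix w assume "w \<in> F ` earring_set"
    then obtain m t where "m \<ge> 1" "t \<in> {0..1}" "w = F (earring_loop m t)"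
      by (auto simp: earring_set_eq)
    then show "w \<in> earring_set"
      using F_loop by (force simp: earring_set_eq)
  qed
  ultimately have "continuous_map earring earring F"
    unfolding earring_def by (auto simp: continuous_map_in_subtopology)
  then have "continuous_map earring earring (restrict F earring_set)"
    by (rule continuous_map_eq) (simp add: earring_def)
  then have "is_earring_shift (restrict F earring_set)"
    unfolding is_earring_shift_def using F_loop by (auto simp: earring_set_eq)
  from this[THEN exI[of is_earring_shift]] show "\<exists>f. is_earring_shift f" .
next
  fix f g assume f: "is_earring_shift f" and g: "is_earring_shift g"
  show "f = g"
  proof (rule extensionalityI[of f earring_set g])
    fix x assume "x \<in> earring_set"
    then obtain m t where "m \<ge> 1" "t \<in> {0..1}" "x = earring_loop m t"
      by (auto simp: earring_set_eq)
    then show "f x = g x" using f g by (simp add: is_earring_shift_def)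
  qed (use f g in \<open>auto simp: is_earring_shift_def\<close>)
qed

lemma earring_shift: "is_earring_shift earring_shift"
  unfolding earring_shift_def by (rule theI'[OF ex1_earring_shift])

end

theory Submission
  imports Defs
begin

text \<open>
  The homotopy \<open>(x, t) \<mapsto> h(x, t)\<close> makes \<open>\<iota> \<circ> p\<close> conjugate in the torus to \<open>\<iota> \<circ> f \<circ> p\<close>, hence to
  \<open>\<iota> \<circ> f^n \<circ> p\<close> for every \<open>n\<close>. The image of \<open>f^n\<close> shrinks to the base point, so it lies in a single member of
  any given open cover for large \<open>n\<close>; thus the class of \<open>\<iota> \<circ> p\<close> is one of the generators of the Spanier group of
  the cover.

  For uncountability, \<open>f\<close> has a left inverse \<open>g\<close> (collapse the first circle, shift the others back),
  and this makes \<open>\<iota>\<close> injective on fundamental groups: a homotopy in the torus lifts to the infinite cyclic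
  cover, a telescope that retracts onto the earring via the powers of \<open>f\<close> and \<open>g\<close>. The
  loops that run, at time \<open>t\<close> with \<open>m = \<lfloor>1/t\<rfloor>\<close>, around the \<open>m\<close>-th circle if \<open>m\<close> lies
  in a given set \<open>S\<close> and rest otherwise are pairwise non-homotopic, because the winding number around the
  \<open>m\<close>-th circle detects whether \<open>m\<close> lies in \<open>S\<close>.
\<close>

section \<open>Loops in a mapping torus\<close>

lemma path_homotopic_homotopic_paths:
  "path_homotopic (top_of_set S) p q \<longleftrightarrow> homotopic_paths S p q"
  by (simp add: path_homotopic_def homotopic_paths_def pathstart_def pathfinish_def)

lemma path_class_eqI:
  assumes "path_homotopic X p q"
  shows "path_class X p = path_class X q"
  using assms path_class_eq_iff path_homotopic_imp(1) by metis

lemma path_rev_loops_at: "p \<in> loops_at X x \<Longrightarrow> path_rev p \<in> loops_at X x"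
  by (simp add: loops_at_def pathin_rev)

lemma path_class_in_carrier: "p \<in> loops_at X x \<Longrightarrow> path_class X p \<in> carrier (fundamental_group X x)"
  by (simp add: carrier_fundamental_group)

lemma comp_loops_at:
  assumes "continuous_map X Y f" "p \<in> loops_at X x"
  shows "f \<circ> p \<in> loops_at Y (f x)"
  using assms pathin_compose by (fastforce simp: loops_at_def)

lemma path_class_rev:
  assumes x: "x \<in> topspace X" and p: "p \<in> loops_at X x"
  shows "path_class X (path_rev p) = inv\<^bsub>fundamental_group X x\<^esub> path_class X p"
proof -
  interpret group "fundamental_group X x" by (rule group_fundamental_group[OF x])
  have "path_homotopic X (path_rev p \<cdot>\<^sub>p p) (\<lambda>t. x)"
    using path_homotopic_rev_concat[of X p] p by (simp add: loops_at_def)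
  then have "path_class X (path_rev p) \<otimes>\<^bsub>fundamental_group X x\<^esub> path_class X p
      = \<one>\<^bsub>fundamental_group X x\<^esub>"
    using fundamental_group_mult[OF path_rev_loops_at[OF p] p]
    by (simp add: path_class_eqI fundamental_group_def)
  then show ?thesis
    using p path_rev_loops_at[OF p] by (intro inv_equality[symmetric]) (auto simp: path_class_in_carrier)
qed

lemma path_class_conjugate:
  assumes x: "x \<in> topspace X" and c: "c \<in> loops_at X x" and p: "p \<in> loops_at X x"
  shows "path_class X (c \<cdot>\<^sub>p p \<cdot>\<^sub>p path_rev c) =
    path_class X c \<otimes>\<^bsub>fundamental_group X x\<^esub> path_class X p
      \<otimes>\<^bsub>fundamental_group X x\<^esub> inv\<^bsub>fundamental_group X x\<^esub> path_class X c"
  using fundamental_group_mult[OF loops_at_concat[OF c p] path_rev_loops_at[OF c]]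
    fundamental_group_mult[OF c p] path_class_rev[OF x c] by simp

text \<open>The square is convex, so its left edge is homotopic to the path along the bottom, right
  and reversed top edges, and \<open>G\<close> carries this homotopy to \<open>Y\<close>. By
  \<open>c\<close> the bottom and top edges have the same image, which turns that path into a
  conjugate.\<close>

lemma path_homotopic_conjugate:
  assumes G: "continuous_map (top_of_set ({0..1} \<times> {0..1})) Y G"
    and c: "\<And>s. s \<in> {0..1} \<Longrightarrow> G (s, 1) = G (s, 0)"
  shows "path_homotopic Y (\<lambda>t. G (0, t))
    ((\<lambda>s. G (s, 0)) \<cdot>\<^sub>p (\<lambda>t. G (1, t)) \<cdot>\<^sub>p path_rev (\<lambda>s. G (s, 0)))"
proof -
  let ?S = "{0..1::real} \<times> {0..1::real}"
  let ?a = "\<lambda>s::real. (s, 0::real)" and ?b = "\<lambda>t::real. (1::real, t)"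
    and ?d = "\<lambda>s::real. (s, 1::real)" and ?e = "\<lambda>t::real. (0::real, t)"
  let ?r = "?a \<cdot>\<^sub>p ?b \<cdot>\<^sub>p path_rev ?d"
  have in_S: "pathin (top_of_set ?S) ?a" "pathin (top_of_set ?S) ?b" "pathin (top_of_set ?S) ?d"
    "pathin (top_of_set ?S) ?e"
    by (auto simp: pathin_def continuous_map_in_subtopology intro!: continuous_intros)
  have r: "pathin (top_of_set ?S) ?r"
    by (intro pathin_concat pathin_rev in_S) simp_all
  have "homotopic_paths ?S ?e ?r"
  proof (rule homotopic_paths_linear)
    show "path ?e" "path ?r"
      using r in_S(4) by (auto simp: pathin_def path_def continuous_map_in_subtopology)
    show "closed_segment (?e t) (?r t) \<subseteq> ?S" if "t \<in> {0..1}" for t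
    proof (rule closed_segment_subset)
      show "convex ?S" by (intro convex_Times convex_real_interval)
      show "?r t \<in> ?S"
        using continuous_map_image_subset_topspace[OF r[unfolded pathin_def]] that
        unfolding topspace_euclidean_subtopology by blast
    qed (use that in auto)
  qed (simp_all add: pathstart_def pathfinish_def)
  then have "path_homotopic Y (G \<circ> ?e) (G \<circ> ?r)"
    by (intro path_homotopic_compose[OF _ G]) (simp add: path_homotopic_homotopic_paths)
  moreover have "path_homotopic Y (G \<circ> ?r)
      ((G \<circ> ?a) \<cdot>\<^sub>p (G \<circ> ?b) \<cdot>\<^sub>p path_rev (G \<circ> ?a))"
  proof (rule path_homotopic_eq)
    show "pathin Y (G \<circ> ?r)" using r G by (rule pathin_compose)
    \<comment> \<open>On the last half the reversed \<open>?d\<close> is evaluated at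
      \<open>1 - (2 * t - 1) = 2 - 2 * t\<close>.\<close>
    show "(G \<circ> ?r) t = ((G \<circ> ?a) \<cdot>\<^sub>p (G \<circ> ?b) \<cdot>\<^sub>p path_rev (G \<circ> ?a)) t"
      if "t \<in> {0..1}" for t
      using that c[of "2 - 2 * t"] by (auto simp: path_concat_def path_rev_def)
  qed
  ultimately have "path_homotopic Y (G \<circ> ?e) ((G \<circ> ?a) \<cdot>\<^sub>p (G \<circ> ?b) \<cdot>\<^sub>p path_rev (G \<circ> ?a))"
    by (rule path_homotopic_trans)
  then show ?thesis by (simp add: o_def)
qed

lemma continuous_map_funpow:
  assumes f: "continuous_map X X f"
  shows "continuous_map X X (f ^^ n)"
proof (induction n)
  case (Suc n)
  then show ?case
    unfolding funpow.simps(2) by (rule continuous_map_compose[OF _ f])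
qed (simp add: id_def)

section \<open>Maps into and out of the mapping torus\<close>

lemma torus_proj_seam:
  assumes "x \<in> topspace X"
  shows "torus_proj X f (x, 1) = torus_proj X f (f x, 0)"
proof -
  have "((x, 1), (f x, 0)) \<in> torus_rel X f"
    unfolding torus_rel_def Let_def by (rule r_into_rtrancl, rule UnI1) (use assms in blast)
  then show ?thesis
    unfolding torus_proj_def by (rule equiv_class_eq[OF equiv_torus_rel])
qed

text \<open>The relation is generated by a single gluing, so \<open>F\<close> is constant along
  every chain of gluings and their inverses. This is how functions descend to the torus.\<close>

lemma torus_proj_eq_imp:
  assumes F: "\<And>x. x \<in> topspace X \<Longrightarrow> F (x, 1) = F (f x, 0)"
    and eq: "torus_proj X f z = torus_proj X f w"
  shows "F z = F w"
proof -
  let ?R = "{((x, 1), (f x, 0)) |x. x \<in> topspace X}"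
  have "(z, w) \<in> torus_rel X f"
    by (rule eq_equiv_class[OF _ equiv_torus_rel]) (use eq in \<open>simp_all add: torus_proj_def\<close>)
  then have "(z, w) \<in> (?R \<union> ?R\<inverse>)\<^sup>*"
    by (simp only: torus_rel_def Let_def)
  then show ?thesis
  proof (induction rule: rtrancl_induct)
    case (step u v)
    from step(2) consider "(u, v) \<in> ?R" | "(v, u) \<in> ?R" by blast
    then have "F u = F v"
    proof cases
      case 1
      then obtain x where "x \<in> topspace X" "u = (x, 1)" "v = (f x, 0)" by blast
      then show ?thesis by (simp only: F)
    next
      case 2
      then obtain x where "x \<in> topspace X" "v = (x, 1)" "u = (f x, 0)" by blast
      then show ?thesis by (simp only: F)
    qed
    then show ?case using step.IH by simp
  qed (rule refl)
qed

lemma continuous_map_torus_proj: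
  "continuous_map (prod_topology X (top_of_set {0..1})) (mapping_torus X f) (torus_proj X f)"
  by (rule quotient_imp_continuous_map[OF quotient_map_torus_proj])

lemma torus_projE:
  assumes "y \<in> topspace (mapping_torus X f)"
  obtains x t where "x \<in> topspace X" "t \<in> {0..1}" "y = torus_proj X f (x, t)"
proof -
  have "y \<in> torus_proj X f ` (topspace X \<times> {0..1})"
    using assms quotient_imp_surjective_map[OF quotient_map_torus_proj, of X f] by simp
  then show ?thesis using that by blast
qed

lemma continuous_map_torus_incl:
  "continuous_map X (mapping_torus X f) (\<lambda>x. torus_proj X f (x, 0))"
proof -
  have "continuous_map X (prod_topology X (top_of_set {0..1})) (\<lambda>x. (x, 0::real))"
    unfolding continuous_map_paired by (simp add: continuous_map_in_subtopology)
  from continuous_map_compose[OF this continuous_map_torus_proj] show ?thesis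
    by (simp add: o_def)
qed

text \<open>The homotopy sends \<open>(s, t)\<close> to \<open>torus_proj X f (p t, s)\<close>; at
  \<open>s = 1\<close> the seam turns it into \<open>\<iota> \<circ> (f \<circ> p)\<close>. Both
  ends of \<open>p\<close> trace \<open>torus_proj X f (x0, s)\<close>, which closes up to the loop
  \<open>c\<close> because \<open>f\<close> fixes \<open>x0\<close>.\<close>

lemma path_class_torus_shift:
  assumes x0: "x0 \<in> topspace X" "f x0 = x0" and p: "p \<in> loops_at X x0"
  defines "\<iota> \<equiv> \<lambda>x. torus_proj X f (x, 0)"
  obtains c where "c \<in> loops_at (mapping_torus X f) (\<iota> x0)"
    "path_class (mapping_torus X f) (\<iota> \<circ> p) =
     path_class (mapping_torus X f) (c \<cdot>\<^sub>p (\<iota> \<circ> (f \<circ> p)) \<cdot>\<^sub>p path_rev c)"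
proof
  let ?I = "top_of_set {0..1::real}"
  let ?T = "mapping_torus X f"
  let ?c = "\<lambda>s. torus_proj X f (x0, s)"
  define G where "G = torus_proj X f \<circ> (\<lambda>z. (p (snd z), fst z))"
  have p': "continuous_map ?I X p" "p 0 = x0" "p 1 = x0"
    using p by (auto simp: loops_at_def pathin_def)
  have "continuous_map (prod_topology ?I ?I) X (p \<circ> snd)"
    by (rule continuous_map_compose[OF continuous_map_snd p'(1)])
  then have G: "continuous_map (prod_topology ?I ?I) ?T G"
    unfolding G_def
    by (intro continuous_map_compose[OF _ continuous_map_torus_proj])
      (simp add: continuous_map_pairwise o_def continuous_map_fst del: prod_topology_subtopology_eu)
  have "pathin ?T (torus_proj X f \<circ> (\<lambda>s. (x0, s)))"
    unfolding pathin_def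
    by (rule continuous_map_compose[OF _ continuous_map_torus_proj])
      (use x0 in \<open>simp add: continuous_map_pairwise o_def\<close>)
  then show "?c \<in> loops_at ?T (\<iota> x0)"
    using x0 torus_proj_seam[of x0 X f] by (simp add: loops_at_def o_def \<iota>_def)
  have "path_homotopic ?T (\<lambda>t. G (0, t))
      ((\<lambda>s. G (s, 0)) \<cdot>\<^sub>p (\<lambda>t. G (1, t)) \<cdot>\<^sub>p path_rev (\<lambda>s. G (s, 0)))"
    by (rule path_homotopic_conjugate) (use G p' in \<open>auto simp: G_def o_def\<close>)
  moreover have "path_homotopic ?T
      ((\<lambda>s. G (s, 0)) \<cdot>\<^sub>p (\<lambda>t. G (1, t)) \<cdot>\<^sub>p path_rev (\<lambda>s. G (s, 0)))
      (?c \<cdot>\<^sub>p (\<iota> \<circ> (f \<circ> p)) \<cdot>\<^sub>p path_rev ?c)"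
  proof (rule path_homotopic_eq)
    show "pathin ?T ((\<lambda>s. G (s, 0)) \<cdot>\<^sub>p (\<lambda>t. G (1, t)) \<cdot>\<^sub>p path_rev (\<lambda>s. G (s, 0)))"
      using path_homotopic_imp(2)[OF calculation] .
    have "G (1, t) = \<iota> (f (p t))" if "t \<in> {0..1}" for t
    proof -
      have "p t \<in> topspace X" using continuous_map_image_subset_topspace[OF p'(1)] that by auto
      then show ?thesis by (simp add: G_def \<iota>_def torus_proj_seam)
    qed
    then show "((\<lambda>s. G (s, 0)) \<cdot>\<^sub>p (\<lambda>t. G (1, t)) \<cdot>\<^sub>p path_rev (\<lambda>s. G (s, 0))) t =
        (?c \<cdot>\<^sub>p (\<iota> \<circ> (f \<circ> p)) \<cdot>\<^sub>p path_rev ?c) t" if "t \<in> {0..1}" for t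
      using that p' by (simp add: path_concat_def path_rev_def G_def)
  qed
  moreover have "\<iota> \<circ> p = (\<lambda>t. G (0, t))"
    by (simp add: G_def \<iota>_def o_def)
  ultimately show "path_class ?T (\<iota> \<circ> p) = path_class ?T (?c \<cdot>\<^sub>p (\<iota> \<circ> (f \<circ> p)) \<cdot>\<^sub>p path_rev ?c)"
    by (simp only: path_class_eqI[OF path_homotopic_trans])
qed

text \<open>The induction step conjugates by \<open>c\<close> for \<open>p\<close> and then by the
  \<open>\<gamma>\<close> found for \<open>f \<circ> p\<close>, so \<open>p\<close> varies in the
  induction. Computing in the group merges both into conjugation by
  \<open>c \<cdot>\<^sub>p \<gamma>\<close> without explicit reparametrizations.\<close>

lemma path_class_torus_shift_funpow:
  assumes f: "continuous_map X X f" and x0: "x0 \<in> topspace X" "f x0 = x0" and p: "p \<in> loops_at X x0"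
  defines "\<iota> \<equiv> \<lambda>x. torus_proj X f (x, 0)"
  shows "\<exists>\<gamma>\<in>loops_at (mapping_torus X f) (\<iota> x0).
    path_class (mapping_torus X f) (\<iota> \<circ> p) =
    path_class (mapping_torus X f) (\<gamma> \<cdot>\<^sub>p (\<iota> \<circ> ((f ^^ n) \<circ> p)) \<cdot>\<^sub>p path_rev \<gamma>)"
  using p
proof (induction n arbitrary: p)
  let ?T = "mapping_torus X f"
  let ?G = "fundamental_group ?T (\<iota> x0)"
  have \<iota>: "continuous_map X ?T \<iota>"
    unfolding \<iota>_def by (rule continuous_map_torus_incl)
  then have top: "\<iota> x0 \<in> topspace ?T"
    using x0(1) by (auto simp: continuous_map_def)
  interpret group ?G by (rule group_fundamental_group[OF top])
  {
    case 0
    let ?e = "\<lambda>t::real. \<iota> x0"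
    have e: "?e \<in> loops_at ?T (\<iota> x0)" by (rule const_loops_at[OF top])
    have one: "path_class ?T ?e = \<one>\<^bsub>?G\<^esub>" by (simp add: fundamental_group_def)
    have "path_class ?T (\<iota> \<circ> p) = path_class ?T (?e \<cdot>\<^sub>p (\<iota> \<circ> p) \<cdot>\<^sub>p path_rev ?e)"
      unfolding path_class_conjugate[OF top e comp_loops_at[OF \<iota> 0]] one
      using path_class_in_carrier[OF comp_loops_at[OF \<iota> 0]] by simp
    then show ?case by (intro bexI[OF _ e]) (simp add: o_def)
  next
    case (Suc n)
    obtain c where c: "c \<in> loops_at ?T (\<iota> x0)" and
      pc: "path_class ?T (\<iota> \<circ> p) = path_class ?T (c \<cdot>\<^sub>p (\<iota> \<circ> (f \<circ> p)) \<cdot>\<^sub>p path_rev c)"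
      using path_class_torus_shift[of x0 X f p, OF x0 Suc.prems] unfolding \<iota>_def .
    have fp: "f \<circ> p \<in> loops_at X x0"
      using comp_loops_at[OF f Suc.prems] by (simp add: x0)
    obtain \<gamma> where \<gamma>: "\<gamma> \<in> loops_at ?T (\<iota> x0)" and
      fpc: "path_class ?T (\<iota> \<circ> (f \<circ> p)) =
        path_class ?T (\<gamma> \<cdot>\<^sub>p (\<iota> \<circ> ((f ^^ n) \<circ> (f \<circ> p))) \<cdot>\<^sub>p path_rev \<gamma>)"
      using Suc.IH[OF fp] by blast
    have "(f ^^ n) x0 = x0" for n by (induction n) (simp_all add: x0)
    then have q: "\<iota> \<circ> ((f ^^ n) \<circ> (f \<circ> p)) \<in> loops_at ?T (\<iota> x0)"
      using comp_loops_at[OF \<iota> comp_loops_at[OF continuous_map_funpow[OF f, of n] fp]] by (simp only:)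
    have "path_class ?T (\<iota> \<circ> p) =
        path_class ?T (c \<cdot>\<^sub>p \<gamma> \<cdot>\<^sub>p (\<iota> \<circ> ((f ^^ n) \<circ> (f \<circ> p))) \<cdot>\<^sub>p path_rev (c \<cdot>\<^sub>p \<gamma>))"
      unfolding pc path_class_conjugate[OF top c comp_loops_at[OF \<iota> fp]] fpc
        path_class_conjugate[OF top \<gamma> q] path_class_conjugate[OF top loops_at_concat[OF c \<gamma>] q]
        fundamental_group_mult[OF c \<gamma>, symmetric]
      using c \<gamma> q by (simp add: path_class_in_carrier inv_mult_group m_assoc)
    moreover have "(f ^^ n) \<circ> (f \<circ> p) = (f ^^ Suc n) \<circ> p"
      by (simp add: fun_eq_iff funpow_swap1)
    ultimately show ?case
      by (intro bexI[OF _ loops_at_concat[OF c \<gamma>]]) (simp only:)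
  }
qed

lemma path_class_torus_in_spanier_group:
  assumes f: "continuous_map X X f" and x0: "x0 \<in> topspace X" "f x0 = x0" and p: "p \<in> loops_at X x0"
    and shrink: "\<And>V. openin X V \<Longrightarrow> x0 \<in> V \<Longrightarrow> \<exists>n. (f ^^ n) ` topspace X \<subseteq> V"
  defines "\<iota> \<equiv> \<lambda>x. torus_proj X f (x, 0)"
  shows "path_class (mapping_torus X f) (\<iota> \<circ> p) \<in> spanier_group (mapping_torus X f) (\<iota> x0)"
  unfolding spanier_group_def
proof (intro InterI, clarify)
  let ?T = "mapping_torus X f"
  fix \<U> assume \<U>: "open_cover ?T \<U>"
  have \<iota>: "continuous_map X ?T \<iota>"
    unfolding \<iota>_def by (rule continuous_map_torus_incl)
  then have "\<iota> x0 \<in> topspace ?T"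
    using x0(1) by (auto simp: continuous_map_def)
  then obtain U where U: "U \<in> \<U>" "\<iota> x0 \<in> U" "openin ?T U"
    using \<U> by (auto simp: open_cover_def)
  \<comment> \<open>\<open>U\<close> pulls back to a neighbourhood of \<open>x0\<close>, and
    \<open>shrink\<close> provides an iterate that sends all of \<open>X\<close> into it, wherever
    \<open>p\<close> runs.\<close>
  have "openin X {x \<in> topspace X. \<iota> x \<in> U}"
    by (rule openin_continuous_map_preimage[OF \<iota> U(3)])
  from shrink[OF this] obtain n where n: "(f ^^ n) ` topspace X \<subseteq> {x \<in> topspace X. \<iota> x \<in> U}"
    using x0(1) U(2) by blast
  obtain \<gamma> where \<gamma>: "\<gamma> \<in> loops_at ?T (\<iota> x0)"
    "path_class ?T (\<iota> \<circ> p) = path_class ?T (\<gamma> \<cdot>\<^sub>p (\<iota> \<circ> ((f ^^ n) \<circ> p)) \<cdot>\<^sub>p path_rev \<gamma>)"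
    using path_class_torus_shift_funpow[OF f x0 p, of n] unfolding \<iota>_def by blast
  have "(f ^^ n) x0 = x0" by (induction n) (simp_all add: x0)
  then have q: "\<iota> \<circ> ((f ^^ n) \<circ> p) \<in> loops_at ?T (\<iota> x0)"
    using comp_loops_at[OF \<iota> comp_loops_at[OF continuous_map_funpow[OF f, of n] p]] by (simp only:)
  have "p ` {0..1} \<subseteq> topspace X"
    using p continuous_map_image_subset_topspace by (fastforce simp: loops_at_def pathin_def)
  then have im: "(\<iota> \<circ> ((f ^^ n) \<circ> p)) ` {0..1} \<subseteq> U"
    using n by auto
  show "path_class ?T (\<iota> \<circ> p) \<in> spanier_cover ?T \<U> (\<iota> x0)"
    unfolding spanier_cover_def \<gamma>(2)
    by (rule generate.incl, rule CollectI, rule exI[of _ \<gamma>], rule exI[of _ "\<iota> \<circ> ((f ^^ n) \<circ> p)"],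
      intro conjI refl bexI[of _ U]) (use \<gamma>(1) q U(1) im in \<open>simp_all add: loops_at_def\<close>)
qed

section \<open>Injectivity on fundamental groups\<close>

text \<open>Distinct logarithms of 1 are at least \<open>2 * pi\<close> apart, so a continuous
  choice cannot vary on a connected set.\<close>

lemma continuous_logarithm_of_1_constant:
  fixes L :: "'a::topological_space \<Rightarrow> complex"
  assumes "connected S" "continuous_on S L" "\<And>x. x \<in> S \<Longrightarrow> exp (L x) = 1"
    and "x \<in> S" "y \<in> S"
  shows "L x = L y"
proof -
  have "L constant_on S"
  proof (rule continuous_discrete_range_constant[OF assms(1,2)])
    fix x assume x: "x \<in> S"
    have "2 * pi \<le> norm (L y - L x)" if "y \<in> S" "L y \<noteq> L x" for y
    proof -
      have "exp (L y - L x) = 1" using x that assms(3) by (simp add: exp_diff)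
      then obtain n :: int where n: "Re (L y - L x) = 0" "Im (L y - L x) = of_int (2 * n) * pi"
        unfolding exp_eq_1 by blast
      have "n \<noteq> 0"
      proof
        assume "n = 0"
        with n have "L y - L x = 0" by (intro complex_eqI) auto
        then show False using that(2) by simp
      qed
      then have "1 \<le> \<bar>real_of_int n\<bar>" by linarith
      then have "2 * pi \<le> \<bar>Im (L y - L x)\<bar>" unfolding n by (simp add: abs_mult)
      then show ?thesis using abs_Im_le_cmod order_trans by blast
    qed
    then show "\<exists>e>0. \<forall>y. y \<in> S \<and> L y \<noteq> L x \<longrightarrow> e \<le> norm (L y - L x)"
      by (intro exI[of _ "2 * pi"]) auto
  qed
  then show ?thesis using assms(4,5) by (auto simp: constant_on_def)
qed

text \<open>Plays the part of the power of \<open>f\<close> with exponent \<open>- n\<close>; as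
  \<open>f\<close> need not be invertible, \<open>g\<close> stands in for its inverse when
  \<open>n\<close> is positive.\<close>

definition torus_shift_power :: "('a \<Rightarrow> 'a) \<Rightarrow> ('a \<Rightarrow> 'a) \<Rightarrow> int \<Rightarrow> 'a \<Rightarrow> 'a" where
  "torus_shift_power f g n = (if n \<ge> 0 then g ^^ nat n else f ^^ nat (- n))"

text \<open>Compatibility with the seam, where \<open>(x, 1)\<close> on level \<open>n\<close> meets
  \<open>(f x, 0)\<close> on level \<open>n + 1\<close>. For \<open>n \<ge> 0\<close> the innermost
  \<open>g\<close> cancels \<open>f\<close>; for negative \<open>n\<close> both sides are the same
  power of \<open>f\<close>.\<close>

lemma torus_shift_power_Suc:
  assumes "g (f x) = x"
  shows "torus_shift_power f g (n + 1) (f x) = torus_shift_power f g n x"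
proof (cases "n \<ge> 0")
  case True
  then have "nat (n + 1) = Suc (nat n)" by simp
  then show ?thesis
    using True assms unfolding torus_shift_power_def by (simp add: funpow_Suc_right del: funpow.simps)
next
  case False
  then have "nat (- n) = Suc (nat (- (n + 1)))" by simp
  then have "(f ^^ nat (- n)) x = (f ^^ nat (- (n + 1))) (f x)"
    by (simp only: funpow_Suc_right o_apply)
  \<comment> \<open>At \<open>n = -1\<close> the index \<open>n + 1\<close> already selects the
    branch of \<open>g\<close>, whose power 0 is the identity.\<close>
  moreover have "n = -1 \<or> \<not> n + 1 \<ge> 0" using False by linarith
  ultimately show ?thesis
    using False unfolding torus_shift_power_def by auto
qed

lemma continuous_map_torus_shift_power:
  assumes "continuous_map X X f" "continuous_map X X g"
  shows "continuous_map X X (torus_shift_power f g n)"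
  using assms by (simp add: torus_shift_power_def continuous_map_funpow)

lemma cis_2pi_eq_iff: "cis (2 * pi * s) = cis (2 * pi * t) \<longleftrightarrow> s - t \<in> \<int>"
proof -
  have "cis (2 * pi * s) = cis (2 * pi * t) \<longleftrightarrow>
      (\<exists>n::int. 2 * pi * s = 2 * pi * t + 2 * of_int n * pi)"
    unfolding cis_conv_exp exp_eq by (simp add: complex_eq_iff)
  also have "\<dots> \<longleftrightarrow> (\<exists>n::int. s - t = of_int n)"
  proof (intro ex_cong1)
    fix n :: int
    have "2 * pi * s = 2 * pi * t + 2 * of_int n * pi \<longleftrightarrow> (2 * pi) * (s - t) = (2 * pi) * of_int n"
      by (simp add: algebra_simps)
    then show "2 * pi * s = 2 * pi * t + 2 * of_int n * pi \<longleftrightarrow> s - t = of_int n" by simp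
  qed
  finally show ?thesis by (auto elim: Ints_cases)
qed

text \<open>
  The infinite cyclic cover of the mapping torus is a telescope of copies of \<^term>\<open>X\<close> indexed by the
  integers. If \<^term>\<open>g\<close> is a left inverse of \<^term>\<open>f\<close>, applying \<open>g^n\<close> (or \<open>f^(-n)\<close> for negative \<open>n\<close>) on
  the \<open>n\<close>-th copy retracts it onto copy 0. A map \<^term>\<open>H\<close> into the torus together with a real lift
  \<^term>\<open>\<theta>\<close> of its circle coordinate is a map into that cover; the lemma composes it with the retraction.
\<close>

lemma mapping_torus_cover_retraction:
  fixes \<theta> :: "'z \<Rightarrow> real"
  assumes f: "continuous_map X X f" and g: "continuous_map X X g"
    and gf: "\<And>x. x \<in> topspace X \<Longrightarrow> g (f x) = x"
    and p: "continuous_map (mapping_torus X f) euclidean p"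
    and p_eq: "\<And>x t. x \<in> topspace X \<Longrightarrow> t \<in> {0..1} \<Longrightarrow>
      p (torus_proj X f (x, t)) = cis (2 * pi * t)"
    and H: "continuous_map Z (mapping_torus X f) H"
    and \<theta>: "continuous_map Z euclideanreal \<theta>"
    and lift: "\<And>z. z \<in> topspace Z \<Longrightarrow> p (H z) = cis (2 * pi * \<theta> z)"
  shows "\<exists>K. continuous_map Z X K \<and>
    (\<forall>z\<in>topspace Z. \<forall>x\<in>topspace X. \<theta> z = 0 \<longrightarrow> H z = torus_proj X f (x, 0) \<longrightarrow> K z = x)"
proof -
  let ?I = "top_of_set {0..1::real}"
  let ?T = "mapping_torus X f"
  define \<sigma> where "\<sigma> = torus_shift_power f g"
  have \<sigma>: "continuous_map X X (\<sigma> n)" for n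
    unfolding \<sigma>_def by (rule continuous_map_torus_shift_power[OF f g])
  have \<sigma>_Suc: "\<sigma> (n + 1) (f x) = \<sigma> n x" if "x \<in> topspace X" for n x
    unfolding \<sigma>_def by (rule torus_shift_power_Suc[of g f x, OF gf[OF that]])
  \<comment> \<open>Moving height 1 to height 0 across the seam makes the value independent of the
    representative: \<open>(x, 1)\<close> and \<open>(f x, 0)\<close> both give \<open>f x\<close>.
    The resulting \<open>\<rho>\<close> may jump at the seam.\<close>
  define \<rho>0 where "\<rho>0 = (\<lambda>(x, t::real). if t < 1 then x else f x)"
  define \<rho> where "\<rho> y = \<rho>0 (SOME w. w \<in> topspace X \<times> {0..1} \<and> torus_proj X f w = y)" for y
  have \<rho>: "\<rho> (torus_proj X f (x, t)) = \<rho>0 (x, t)" if "x \<in> topspace X" "t \<in> {0..1}" for x t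
    unfolding \<rho>_def
  proof (rule torus_proj_eq_imp[of X \<rho>0 f])
    show "torus_proj X f (SOME w. w \<in> topspace X \<times> {0..1} \<and> torus_proj X f w = torus_proj X f (x, t))
        = torus_proj X f (x, t)"
      by (rule someI2[of _ "(x, t)"]) (use that in auto)
  qed (simp add: \<rho>0_def)
  \<comment> \<open>The floor jumps where \<open>\<theta>\<close> crosses the seam, and by
    \<open>\<sigma>_Suc\<close> this compensates the jump of \<open>\<rho>\<close>.\<close>
  define K where "K z = \<sigma> \<lfloor>\<theta> z\<rfloor> (\<rho> (H z))" for z
  \<comment> \<open>Continuity is checked on the preimages of the intervals from
    \<open>c + n\<close> to \<open>c + n + 1\<close>. Cutting at a height \<open>c\<close> strictly
    between 0 and 1 puts the seam inside a piece.\<close>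
  define J where "J = {0<..<1::real} \<times> (UNIV :: int set)"
  define V where "V = (\<lambda>(c, n). {z \<in> topspace Z. \<theta> z \<in> {c + real_of_int n <..< c + real_of_int n + 1}})"
  have "continuous_map Z X K"
  proof (rule pasting_lemma[of J Z V X "\<lambda>j. K" K])
    fix j assume "j \<in> J"
    then obtain c n where j: "j = (c, n)" and c: "0 < c" "c < 1" by (auto simp: J_def)
    show "openin Z (V j)"
      unfolding V_def j prod.case by (rule openin_continuous_map_preimage[OF \<theta>]) simp
    define W where "W = {y \<in> topspace ?T. p y \<in> - {cis (2 * pi * c)}}"
    define D where "D = {w \<in> topspace X \<times> {0..1}. snd w \<noteq> c}"
    \<comment> \<open>On \<open>V (c, n)\<close> a height above \<open>c\<close> belongs to level
      \<open>n\<close> and one below \<open>c\<close> to level \<open>n + 1\<close>, so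
      \<open>F\<close> is \<open>K\<close> in cylinder coordinates. Its two branches never meet,
      since \<open>D\<close> omits the height \<open>c\<close>.\<close>
    define F where "F = (\<lambda>w. if snd w \<le> c then (\<sigma> (n + 1) \<circ> fst) w else (\<sigma> n \<circ> fst) w)"
    have W: "openin ?T W"
      unfolding W_def by (rule openin_continuous_map_preimage[OF p]) (simp add: open_Compl)
    have "{w \<in> topspace (prod_topology X ?I). torus_proj X f w \<in> W} = D"
    proof -
      have "torus_proj X f (x, t) \<in> W \<longleftrightarrow> t \<noteq> c" if "x \<in> topspace X" "t \<in> {0..1}" for x t
      proof -
        have "torus_proj X f (x, t) \<in> topspace ?T"
          using continuous_map_image_subset_topspace[OF continuous_map_torus_proj, of X f] that by auto
        moreover have "t - c \<in> \<int> \<longleftrightarrow> t = c"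
        proof
          assume "t - c \<in> \<int>"
          then obtain k where k: "t - c = of_int k" by (rule Ints_cases)
          with that c have "-1 < real_of_int k" "real_of_int k < 1" by auto
          then have "k = 0" by linarith
          with k show "t = c" by simp
        qed simp
        ultimately show ?thesis
          using that by (simp add: W_def p_eq cis_2pi_eq_iff)
      qed
      then show ?thesis by (auto simp: D_def)
    qed
    \<comment> \<open>\<open>D\<close> is the full preimage of the open set \<open>W\<close>, so the
      restricted projection is again a quotient map and \<open>F\<close> can descend.\<close>
    then have quot: "quotient_map (subtopology (prod_topology X ?I) D) (subtopology ?T W) (torus_proj X f)"
      using quotient_map_restriction[OF quotient_map_torus_proj] W by blast
    have "continuous_map (subtopology (prod_topology X ?I) D) X F"
      unfolding F_def
    proof (rule continuous_map_cases_le)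
      have "continuous_map (prod_topology X ?I) euclideanreal snd"
        using continuous_map_snd[of X ?I] unfolding continuous_map_in_subtopology by blast
      then show "continuous_map (subtopology (prod_topology X ?I) D) euclideanreal snd"
        by (rule continuous_map_from_subtopology)
      have "continuous_map (prod_topology X ?I) X (\<sigma> m \<circ> fst)" for m
        by (rule continuous_map_compose[OF continuous_map_fst \<sigma>])
      then have \<sigma>_fst: "continuous_map (subtopology (subtopology (prod_topology X ?I) D) U) X (\<sigma> m \<circ> fst)"
        for U m by (intro continuous_map_from_subtopology)
      show "continuous_map (subtopology (subtopology (prod_topology X ?I) D)
          {w \<in> topspace (subtopology (prod_topology X ?I) D). snd w \<le> c}) X (\<sigma> (n + 1) \<circ> fst)"
        by (rule \<sigma>_fst)
      show "continuous_map (subtopology (subtopology (prod_topology X ?I) D)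
          {w \<in> topspace (subtopology (prod_topology X ?I) D). c \<le> snd w}) X (\<sigma> n \<circ> fst)"
        by (rule \<sigma>_fst)
    qed (simp_all add: D_def)
    then obtain F' where F': "continuous_map (subtopology ?T W) X F'"
      "\<And>w. w \<in> topspace (subtopology (prod_topology X ?I) D) \<Longrightarrow> F' (torus_proj X f w) = F w"
    proof (rule quotient_map_lift_exists[OF quot])
      \<comment> \<open>Since \<open>0 < c < 1\<close>, the point \<open>(x, 1)\<close> falls in the
        upper branch and \<open>(f x, 0)\<close> in the lower one; \<open>\<sigma>_Suc\<close>
        equates their values.\<close>
      show "F v = F w" if "torus_proj X f v = torus_proj X f w" for v w
        using that by (rule torus_proj_eq_imp[rotated]) (use c in \<open>auto simp: F_def \<sigma>_Suc\<close>)
    qed blast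
    have F'K: "H z \<in> W \<and> F' (H z) = K z" if z: "z \<in> V (c, n)" for z
    proof -
      have zZ: "z \<in> topspace Z" and \<theta>z: "c + n < \<theta> z" "\<theta> z < c + n + 1"
        using z by (auto simp: V_def)
      have "H z \<in> topspace ?T"
        using continuous_map_image_subset_topspace[OF H] zZ by blast
      then obtain x t where xt: "x \<in> topspace X" "t \<in> {0..1}" "H z = torus_proj X f (x, t)"
        by (rule torus_projE)
      have "cis (2 * pi * \<theta> z) = cis (2 * pi * t)"
        using lift[OF zZ] p_eq[OF xt(1,2)] by (simp only: xt(3))
      then have "\<theta> z - t \<in> \<int>" by (simp only: cis_2pi_eq_iff)
      then obtain k where k: "\<theta> z = t + of_int k" by (elim Ints_cases) (simp add: algebra_simps)
      have "t \<noteq> c"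
      proof
        assume "t = c"
        with \<theta>z k have "real_of_int n < of_int k" "real_of_int k < of_int (n + 1)" by auto
        then show False unfolding of_int_less_iff by simp
      qed
      then have "(x, t) \<in> D" using xt by (simp add: D_def)
      then have "(x, t) \<in> topspace (subtopology (prod_topology X ?I) D)" using xt by simp
      then have "torus_proj X f (x, t) \<in> topspace (subtopology ?T W)" "F' (torus_proj X f (x, t)) = F (x, t)"
        using F'(2) continuous_map_image_subset_topspace[OF quotient_imp_continuous_map[OF quot]] by blast+
      then have w: "H z \<in> W" "F' (H z) = F (x, t)"
        unfolding xt(3) topspace_subtopology by simp_all
      have "F (x, t) = \<sigma> \<lfloor>\<theta> z\<rfloor> (\<rho>0 (x, t))"
      proof (cases "t < c")
        case True
        have "real_of_int n < of_int k" "of_int k < real_of_int (n + 2)"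
          using True \<theta>z k c xt(2) by auto
        then have "k = n + 1" unfolding of_int_less_iff by simp
        moreover have "\<lfloor>\<theta> z\<rfloor> = k" unfolding k using True c xt(2) by (simp add: floor_eq_iff)
        ultimately show ?thesis using True c by (simp add: F_def \<rho>0_def)
      next
        case False
        with \<open>t \<noteq> c\<close> have "c < t" by simp
        have "real_of_int (n - 1) < of_int k" "of_int k < real_of_int (n + 1)"
          using \<open>c < t\<close> \<theta>z k c xt(2) by auto
        then have "k = n" unfolding of_int_less_iff by simp
        show ?thesis
        proof (cases "t < 1")
          case True
          then have "\<lfloor>\<theta> z\<rfloor> = n" unfolding k \<open>k = n\<close> using xt(2) by (simp add: floor_eq_iff)
          then show ?thesis using True \<open>c < t\<close> by (simp add: F_def \<rho>0_def)
        next
          case False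
          \<comment> \<open>Here the floor is \<open>n + 1\<close> and \<open>\<rho>0\<close> gives
            \<open>f x\<close>, so \<open>\<sigma>_Suc\<close> leads back to
            \<open>\<sigma> n x\<close>.\<close>
          then have "t = 1" using xt(2) by simp
          then have "\<lfloor>\<theta> z\<rfloor> = n + 1" unfolding k \<open>k = n\<close> by simp
          then show ?thesis using \<open>t = 1\<close> c by (simp add: F_def \<rho>0_def \<sigma>_Suc xt(1))
        qed
      qed
      then show ?thesis
        unfolding K_def using w xt by (simp add: \<rho>)
    qed
    have "continuous_map (subtopology Z (V j)) (subtopology ?T W) H"
      using H F'K by (auto simp: continuous_map_in_subtopology continuous_map_from_subtopology j)
    from continuous_map_compose[OF this F'(1)]
    show "continuous_map (subtopology Z (V j)) X K"
      by (rule continuous_map_eq) (use F'K j in auto)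
  next
    fix z assume z: "z \<in> topspace Z"
    \<comment> \<open>Any cut that avoids the fractional part of \<open>\<theta> z\<close> leaves
      \<open>z\<close> inside a piece; of two candidates at least one does.\<close>
    obtain c where c: "0 < c" "c < 1" "c \<noteq> frac (\<theta> z)"
      by (rule that[of "if frac (\<theta> z) = 1 / 2 then 1 / 3 else 1 / 2"]) auto
    have "\<theta> z - c \<notin> \<int>"
    proof
      assume "\<theta> z - c \<in> \<int>"
      then have "frac (\<theta> z) = c" using c by (simp add: frac_unique_iff)
      then show False using c by simp
    qed
    then have "of_int \<lfloor>\<theta> z - c\<rfloor> < \<theta> z - c"
      by (metis Ints_of_int floor_correct less_le)
    then have "c + of_int \<lfloor>\<theta> z - c\<rfloor> < \<theta> z" "\<theta> z < c + of_int \<lfloor>\<theta> z - c\<rfloor> + 1"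
      using real_of_int_floor_add_one_gt[of "\<theta> z - c"] by linarith+
    then have "z \<in> V (c, \<lfloor>\<theta> z - c\<rfloor>)"
      using z by (simp add: V_def)
    then show "\<exists>j. j \<in> J \<and> z \<in> V j \<and> K z = K z"
      using c by (auto simp: J_def)
  qed simp
  moreover have "K z = x" if "\<theta> z = 0" "x \<in> topspace X" "H z = torus_proj X f (x, 0)" for z x
    using that by (simp add: K_def \<rho> \<rho>0_def \<sigma>_def torus_shift_power_def)
  ultimately show ?thesis by blast
qed


text \<open>The circle coordinate of a homotopy \<open>H\<close> lifts to a real function
  \<open>\<theta>\<close> because the square is contractible. The boundary of the square stays in
  the zero level, so \<open>\<theta>\<close> vanishes there, and the retraction turns
  \<open>H\<close> into a homotopy in \<open>X\<close> with the original boundary values.\<close>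

lemma path_homotopic_mapping_torusD:
  assumes f: "continuous_map X X f" and g: "continuous_map X X g"
    and gf: "\<And>x. x \<in> topspace X \<Longrightarrow> g (f x) = x"
    and p: "pathin X p" and q: "pathin X q"
    and pq: "path_homotopic (mapping_torus X f)
      ((\<lambda>x. torus_proj X f (x, 0)) \<circ> p) ((\<lambda>x. torus_proj X f (x, 0)) \<circ> q)"
  shows "path_homotopic X p q"
proof -
  let ?I = "top_of_set {0..1::real}"
  let ?T = "mapping_torus X f"
  let ?S = "{0..1::real} \<times> {0..1::real}"
  let ?\<iota> = "\<lambda>x. torus_proj X f (x, 0)"
  let ?E = "\<lambda>t::real. cis (2 * pi * t)"
  \<comment> \<open>The circle coordinate of the torus; it respects the seam because heights 0 and 1
    give the same point of the circle.\<close>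
  obtain \<pi> where \<pi>: "continuous_map ?T euclidean \<pi>"
    "\<And>w. w \<in> topspace (prod_topology X ?I) \<Longrightarrow> \<pi> (torus_proj X f w) = ?E (snd w)"
  proof (rule quotient_map_lift_exists[OF quotient_map_torus_proj[of X f]])
    have "continuous_map ?I euclidean ?E"
      by (auto intro!: continuous_intros)
    from continuous_map_compose[OF continuous_map_snd this]
    show "continuous_map (prod_topology X ?I) euclidean (\<lambda>w. ?E (snd w))"
      by (simp add: o_def)
    show "?E (snd v) = ?E (snd w)" if "torus_proj X f v = torus_proj X f w" for v w
      using that
    proof (rule torus_proj_eq_imp[rotated])
      show "?E (snd (x, 1)) = ?E (snd (f x, 0))" for x :: 'a
        by (simp only: cis_2pi_eq_iff snd_conv) simp
    qed
  qed blast
  have \<pi>_eq: "\<pi> (torus_proj X f (x, t)) = ?E t" if "x \<in> topspace X" "t \<in> {0..1}" for x t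
    using \<pi>(2)[of "(x, t)"] that by simp
  obtain H where H: "continuous_map (top_of_set ?S) ?T H"
    "\<And>t. H (0, t) = ?\<iota> (p t)" "\<And>t. H (1, t) = ?\<iota> (q t)"
    "\<And>s. s \<in> {0..1} \<Longrightarrow> H (s, 0) = ?\<iota> (p 0) \<and> H (s, 1) = ?\<iota> (p 1)"
    using pq unfolding path_homotopic_def homotopic_with_def by (auto simp: o_def)
  have pX: "p t \<in> topspace X" and qX: "q t \<in> topspace X" if "t \<in> {0..1}" for t
    using p q that continuous_map_image_subset_topspace
    unfolding pathin_def by fastforce+
  have cont: "continuous_on ?S (\<pi> \<circ> H)"
    using continuous_map_compose[OF H(1) \<pi>(1)] by simp
  have contr: "contractible ?S"
    by (intro convex_imp_contractible convex_Times convex_real_interval)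
  have nz: "(\<pi> \<circ> H) z \<noteq> 0" if "z \<in> ?S" for z
  proof -
    have "H z \<in> topspace ?T"
      using continuous_map_image_subset_topspace[OF H(1)] that
      unfolding topspace_euclidean_subtopology by blast
    then obtain x t where "x \<in> topspace X" "t \<in> {0..1}" "H z = torus_proj X f (x, t)"
      by (rule torus_projE)
    then show ?thesis by (simp add: \<pi>_eq)
  qed
  obtain L where L: "continuous_on ?S L" "\<And>z. z \<in> ?S \<Longrightarrow> (\<pi> \<circ> H) z = exp (L z)"
    using continuous_logarithm_on_contractible[OF cont contr nz] by blast
  have unit: "\<pi> (?\<iota> x) = 1" if "x \<in> topspace X" for x
    using \<pi>_eq[of x 0] that by simp
  have I: "0 \<in> {0..1::real}" "1 \<in> {0..1::real}" by auto
  have L1: "exp (L (0, t)) = 1" "exp (L (1, t)) = 1" "exp (L (t, 0)) = 1" "exp (L (t, 1)) = 1"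
    if "t \<in> {0..1}" for t
    using that L(2)[of "(0, t)"] L(2)[of "(1, t)"] L(2)[of "(t, 0)"] L(2)[of "(t, 1)"]
      pX[OF that] qX[OF that] pX[OF I(1)] pX[OF I(2)] H(2-4) unit by simp_all
  have const: "L z = L w" if "connected A" "A \<subseteq> ?S" "\<And>z. z \<in> A \<Longrightarrow> exp (L z) = 1" "z \<in> A" "w \<in> A" for A z w
    using continuous_logarithm_of_1_constant[OF that(1) continuous_on_subset[OF L(1) that(2)] that(3-5)] .
  have conn: "connected ({a} \<times> {0..1::real})" "connected ({0..1::real} \<times> {a})" for a :: real
    by (intro connected_Times) auto
  have left: "L (0, t) = L (0, 0)" if "t \<in> {0..1}" for t
    by (rule const[OF conn(1)[of 0]]) (use that L1 in auto)
  have bottom: "L (t, 0) = L (0, 0)" if "t \<in> {0..1}" for t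
    by (rule const[OF conn(2)[of 0]]) (use that L1 in auto)
  have right: "L (1, t) = L (0, 0)" if "t \<in> {0..1}" for t
  proof -
    have "L (1, t) = L (1, 0)"
      by (rule const[OF conn(1)[of 1]]) (use that L1 in auto)
    then show ?thesis using bottom[of 1] by simp
  qed
  have top: "L (t, 1) = L (0, 0)" if "t \<in> {0..1}" for t
  proof -
    have "L (t, 1) = L (0, 1)"
      by (rule const[OF conn(2)[of 1]]) (use that L1 in auto)
    then show ?thesis using left[of 1] by simp
  qed
  \<comment> \<open>Subtracting the value at the corner makes \<open>\<theta>\<close> zero on all
    four edges, where \<open>L\<close> is constant.\<close>
  define \<theta> where "\<theta> z = Im (L z - L (0, 0)) / (2 * pi)" for z
  have lift: "\<pi> (H z) = ?E (\<theta> z)" if "z \<in> ?S" for z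
  proof -
    have "H z \<in> topspace ?T"
      using continuous_map_image_subset_topspace[OF H(1)] that
      unfolding topspace_euclidean_subtopology by blast
    then obtain x t where xt: "x \<in> topspace X" "t \<in> {0..1}" "H z = torus_proj X f (x, t)"
      by (rule torus_projE)
    have "exp (L z) = cis (2 * pi * t)"
      unfolding L(2)[OF that, symmetric] o_apply xt(3) by (rule \<pi>_eq[OF xt(1,2)])
    then have "norm (exp (L z)) = 1" by simp
    moreover have "norm (exp (L (0, 0))) = 1" using L1(1)[of 0] by simp
    ultimately have "Re (L z - L (0, 0)) = 0" by simp
    then have "L z - L (0, 0) = \<i> * of_real (2 * pi * \<theta> z)"
      by (intro complex_eqI) (simp_all add: \<theta>_def)
    moreover have "exp (L z - L (0, 0)) = \<pi> (H z)"
      using L(2)[OF that] L1(1)[of 0] by (simp add: exp_diff)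
    ultimately show ?thesis by (simp only: cis_conv_exp)
  qed
  have \<theta>: "continuous_map (top_of_set ?S) euclideanreal \<theta>"
    unfolding \<theta>_def using L(1) by (auto intro!: continuous_intros)
  have "\<exists>K. continuous_map (top_of_set ?S) X K \<and> (\<forall>z\<in>topspace (top_of_set ?S). \<forall>x\<in>topspace X.
      \<theta> z = 0 \<longrightarrow> H z = torus_proj X f (x, 0) \<longrightarrow> K z = x)"
    by (rule mapping_torus_cover_retraction[OF f g _ \<pi>(1) _ H(1) \<theta>])
      (erule gf, erule (1) \<pi>_eq, rule lift, simp only: topspace_euclidean_subtopology)
  then obtain K where K: "continuous_map (top_of_set ?S) X K"
    "\<And>z x. z \<in> ?S \<Longrightarrow> x \<in> topspace X \<Longrightarrow> \<theta> z = 0 \<Longrightarrow> H z = torus_proj X f (x, 0) \<Longrightarrow> K z = x"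
    unfolding topspace_euclidean_subtopology by blast
  have K_left: "K (0, t) = p t" if t: "t \<in> {0..1}" for t
    by (rule K(2)[OF _ pX[OF t] _ H(2)]) (use t left[OF t] in \<open>simp_all add: \<theta>_def\<close>)
  have K_right: "K (1, t) = q t" if t: "t \<in> {0..1}" for t
    by (rule K(2)[OF _ qX[OF t] _ H(3)]) (use t right[OF t] in \<open>simp_all add: \<theta>_def\<close>)
  have K_bottom: "K (t, 0) = p 0" if t: "t \<in> {0..1}" for t
    by (rule K(2)[OF _ pX[OF I(1)] _ H(4)[OF t, THEN conjunct1]])
      (use t bottom[OF t] in \<open>simp_all add: \<theta>_def\<close>)
  have K_top: "K (t, 1) = p 1" if t: "t \<in> {0..1}" for t
    by (rule K(2)[OF _ pX[OF I(2)] _ H(4)[OF t, THEN conjunct2]])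
      (use t top[OF t] in \<open>simp_all add: \<theta>_def\<close>)
  \<comment> \<open>\<open>K\<close> is known to agree with \<open>p\<close> and \<open>q\<close>
    only on the unit interval, while the definition asks for equality at every real; this form
    restricts the demand to the interval.\<close>
  have "homotopic_with (\<lambda>r. r 0 = p 0 \<and> r 1 = p 1) ?I X p q \<longleftrightarrow>
      (\<exists>h. continuous_map (prod_topology ?I ?I) X h \<and>
        (\<forall>x\<in>topspace ?I. h (0, x) = p x) \<and> (\<forall>x\<in>topspace ?I. h (1, x) = q x) \<and>
        (\<forall>t\<in>{0..1}. h (t, 0) = p 0 \<and> h (t, 1) = p 1))"
    by (rule homotopic_with) simp
  moreover have "continuous_map (prod_topology ?I ?I) X K" using K(1) by simp
  ultimately show ?thesis
    unfolding path_homotopic_def topspace_euclidean_subtopology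
    using K_left K_right K_bottom K_top by blast
qed

section \<open>The Hawaiian earring\<close>

text \<open>Periodicity makes the loops usable at every real parameter, in particular at
  \<open>1 / t\<close> in \<open>earring_word\<close>.\<close>

lemma earring_loop_frac: "earring_loop m (frac t) = earring_loop m t"
proof -
  have "2 * pi * frac t = 2 * pi * t - (2 * pi) * of_int \<lfloor>t\<rfloor>"
    by (simp add: frac_def algebra_simps)
  then show ?thesis
    by (simp only: earring_loop_def cos_diff sin_diff cos_int_2pin sin_int_2pin) simp
qed

lemma earring_loop_in_set: "m \<ge> 1 \<Longrightarrow> earring_loop m t \<in> earring_set"
  unfolding earring_set_eq
  by (rule UN_I[of m], simp, rule image_eqI[of _ _ "frac t"])
    (auto intro: less_imp_le simp: frac_lt_1 earring_loop_frac)

lemma earring_setE: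
  assumes "z \<in> earring_set"
  obtains m t where "m \<ge> 1" "t \<in> {0..1}" "z = earring_loop m t"
  using assms by (auto simp: earring_set_eq)

lemma norm_earring_loop: "(norm (earring_loop m t))\<^sup>2 = 2 * (1 - cos (2 * pi * t)) / (real m)\<^sup>2"
proof -
  define c s where "c = cos (2 * pi * t)" and "s = sin (2 * pi * t)"
  have cs: "s * s = 1 - c * c"
    unfolding c_def s_def by (metis power2_eq_square sin_squared_eq)
  have "(norm (earring_loop m t))\<^sup>2 = ((1 - c) * (1 - c) + s * s) / (real m)\<^sup>2"
    by (simp add: earring_loop_def norm_prod_def power2_eq_square add_divide_distrib c_def s_def)
  also have "\<dots> = 2 * (1 - c) / (real m)\<^sup>2"
    unfolding cs by (simp add: algebra_simps)
  finally show ?thesis by (simp only: c_def)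
qed

lemma norm_earring_loop_le: "norm (earring_loop m t) \<le> 2 / real m"
proof (rule power2_le_imp_le)
  have "2 * (1 - c) \<le> 4" if "-1 \<le> c" for c :: real using that by simp
  then have "2 * (1 - cos (2 * pi * t)) \<le> 4" using cos_ge_minus_one .
  then show "(norm (earring_loop m t))\<^sup>2 \<le> (2 / real m)\<^sup>2"
    unfolding norm_earring_loop power_divide by (intro divide_right_mono) auto
qed simp

text \<open>The \<open>m\<close>-th circle is \<open>x^2 + y^2 = 2x/m\<close>.\<close>

definition earring_index :: "real \<times> real \<Rightarrow> real" where
  "earring_index z = 2 * fst z / (norm z)\<^sup>2"

lemma earring_index_loop:
  assumes "m \<ge> 1" "earring_loop m t \<noteq> 0"
  shows "earring_index (earring_loop m t) = real m"
proof -
  have "(norm (earring_loop m t))\<^sup>2 \<noteq> 0" using assms(2) by simp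
  then have "1 - cos (2 * pi * t) \<noteq> 0" unfolding norm_earring_loop by auto
  then show ?thesis
    using assms(1) unfolding earring_index_def norm_earring_loop
    by (simp add: earring_loop_def power2_eq_square divide_simps)
qed

text \<open>At the origin the index does not determine the circle, but any factor times zero is
  zero.\<close>

lemma earring_scale_loop:
  "m \<ge> 1 \<Longrightarrow> a (earring_index (earring_loop m t)) *\<^sub>R earring_loop m t = a (real m) *\<^sub>R earring_loop m t"
  using earring_index_loop by (cases "earring_loop m t = 0") simp_all

text \<open>Away from the origin the index is continuous and integer-valued, hence locally constant;
  at the origin the bound on the factors squeezes the value to 0. The left inverse of the shift and
  the collapse onto a single circle are both of this form.\<close>

lemma continuous_on_earring_scale:
  assumes bound: "\<And>k::nat. k \<ge> 1 \<Longrightarrow> \<bar>a (real k)\<bar> \<le> B"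
  shows "continuous_on earring_set (\<lambda>z. a (earring_index z) *\<^sub>R z)"
  unfolding continuous_on_def
proof
  fix z assume z: "z \<in> earring_set"
  show "((\<lambda>z. a (earring_index z) *\<^sub>R z) \<longlongrightarrow> a (earring_index z) *\<^sub>R z) (at z within earring_set)"
  proof (cases "z = 0")
    case True
    have "norm (a (earring_index w) *\<^sub>R w) \<le> B * norm w" if "w \<in> earring_set" for w
      using that
    proof (rule earring_setE)
      fix m t assume m: "m \<ge> 1" and w: "w = earring_loop m t"
      show ?thesis
        unfolding w earring_scale_loop[OF m, of a t] norm_scaleR
        by (intro mult_right_mono bound[OF m]) simp
    qed
    then have "eventually (\<lambda>w. norm (a (earring_index w) *\<^sub>R w) \<le> B * norm w) (at 0 within earring_set)"
      by (simp add: eventually_at_filter)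
    moreover have "((\<lambda>w. B * norm w) \<longlongrightarrow> 0) (at (0::real \<times> real) within earring_set)"
      by (intro tendsto_mult_right_zero tendsto_norm_zero tendsto_ident_at)
    ultimately have "((\<lambda>w. a (earring_index w) *\<^sub>R w) \<longlongrightarrow> 0) (at 0 within earring_set)"
      by (rule Lim_null_comparison)
    then show ?thesis by (simp add: True)
  next
    case False
    from z obtain m t where m: "m \<ge> 1" "z = earring_loop m t" by (rule earring_setE)
    have "(earring_index \<longlongrightarrow> earring_index z) (at z within earring_set)"
      unfolding earring_index_def by (intro tendsto_intros) (use False in auto)
    then have "eventually (\<lambda>w. dist (earring_index w) (earring_index z) < 1) (at z within earring_set)"
      by (rule tendstoD) simp
    moreover have "eventually (\<lambda>w. w \<noteq> 0) (at z within earring_set)"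
      using tendsto_imp_eventually_ne[OF tendsto_ident_at False] .
    moreover have "eventually (\<lambda>w. w \<in> earring_set) (at z within earring_set)"
      by (simp add: eventually_at_filter)
    ultimately have "eventually (\<lambda>w. a (earring_index z) *\<^sub>R w = a (earring_index w) *\<^sub>R w)
        (at z within earring_set)"
    proof eventually_elim
      case (elim w)
      from elim(3) obtain k s where k: "k \<ge> 1" "w = earring_loop k s" by (rule earring_setE)
      then have "earring_index w = real k" "earring_index z = real m"
        using elim(2) False m earring_index_loop by auto
      then have "earring_index w = earring_index z"
        using elim(1) by (simp add: dist_real_def)
      then show ?case by simp
    qed
    moreover have "((\<lambda>w. a (earring_index z) *\<^sub>R w) \<longlongrightarrow> a (earring_index z) *\<^sub>R z) (at z within earring_set)"
      by (intro tendsto_intros)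
    ultimately show ?thesis
      by (rule Lim_transform_eventually[rotated])
  qed
qed

section \<open>The shift map and its left inverse\<close>

lemma continuous_map_earring_shift: "continuous_map earring earring earring_shift"
  using earring_shift by (simp add: is_earring_shift_def)

lemma earring_shift_loop: "m \<ge> 1 \<Longrightarrow> earring_shift (earring_loop m t) = earring_loop (m + 1) t"
  using earring_shift earring_loop_frac[of _ t] less_imp_le[OF frac_lt_1[of t]]
  unfolding is_earring_shift_def by (metis atLeastAtMost_iff frac_ge_0)

lemma earring_shift_funpow_loop:
  "m \<ge> 1 \<Longrightarrow> (earring_shift ^^ n) (earring_loop m t) = earring_loop (m + n) t"
  by (induction n) (simp_all add: earring_shift_loop)

lemma topspace_earring: "topspace earring = earring_set"
  by (simp add: earring_def)

lemma zero_in_earring: "(0, 0) \<in> topspace earring"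
  using earring_loop_in_set[of 1 0] by (simp add: topspace_earring earring_loop_def)

lemma earring_shift_zero: "earring_shift (0, 0) = (0, 0)"
  using earring_shift_loop[of 1 0] by (simp add: earring_loop_def)

lemma earring_shift_shrinks:
  assumes "openin earring V" "(0, 0) \<in> V"
  shows "\<exists>n. (earring_shift ^^ n) ` topspace earring \<subseteq> V"
proof -
  obtain U where U: "open U" "V = U \<inter> earring_set"
    using assms(1) unfolding earring_def openin_open by blast
  then obtain e where e: "e > 0" "ball (0, 0) e \<subseteq> U"
    using assms(2) open_contains_ball by blast
  \<comment> \<open>The iterate sends circle \<open>m\<close> to circle \<open>m + n\<close>, whose
    points have norm at most \<open>2 / (m + n)\<close>.\<close>
  obtain n :: nat where n: "2 / e < real n" using reals_Archimedean2 by blast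
  have "(earring_shift ^^ n) z \<in> V" if "z \<in> earring_set" for z
    using that
  proof (rule earring_setE)
    fix m t assume m: "m \<ge> 1" and z: "z = earring_loop m t"
    have "2 / e < real (m + n)" using n by simp
    then have "2 / real (m + n) < e" using e(1) m by (simp add: field_simps)
    then have "norm (earring_loop (m + n) t) < e"
      using norm_earring_loop_le order_le_less_trans by blast
    then have "earring_loop (m + n) t \<in> ball (0, 0) e"
      by (simp add: zero_prod_def[symmetric])
    then show ?thesis
      using e(2) U(2) m earring_loop_in_set[of "m + n" t] by (auto simp: z earring_shift_funpow_loop)
  qed
  then show ?thesis unfolding topspace_earring by blast
qed

text \<open>The factor \<open>k / (k - 1)\<close> takes radius \<open>1 / k\<close> to
  \<open>1 / (k - 1)\<close>. It is at most 2 for \<open>k \<ge> 2\<close>, which gives continuity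
  at the origin.\<close>

lemma earring_shift_left_inverse:
  obtains g where "continuous_map earring earring g"
    "\<And>z. z \<in> topspace earring \<Longrightarrow> g (earring_shift z) = z"
proof
  \<comment> \<open>On the first circle the factor is \<open>1 / 0 = 0\<close>, so that circle is collapsed.\<close>
  define a where "a k = k / (k - 1)" for k :: real
  define g where "g z = a (earring_index z) *\<^sub>R z" for z
  have g1: "g (earring_loop 1 t) = 0" for t
    using earring_scale_loop[of 1 a t] by (simp add: g_def a_def)
  have g_Suc: "g (earring_loop (m + 1) t) = earring_loop m t" if "m \<ge> 1" for m t
  proof -
    have "g (earring_loop (m + 1) t) = a (real (m + 1)) *\<^sub>R earring_loop (m + 1) t"
      unfolding g_def by (rule earring_scale_loop) simp
    then show ?thesis using that by (simp add: a_def earring_loop_def divide_simps)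
  qed
  show "g (earring_shift z) = z" if "z \<in> topspace earring" for z
    using that unfolding topspace_earring
    by (rule earring_setE) (use g_Suc in \<open>simp add: earring_shift_loop\<close>)
  have "g z \<in> earring_set" if "z \<in> earring_set" for z
    using that
  proof (rule earring_setE)
    fix m t assume m: "m \<ge> 1" "z = earring_loop m t"
    show ?thesis
    proof (cases "m = 1")
      case True
      then show ?thesis using m g1 zero_in_earring by (simp add: topspace_earring zero_prod_def)
    next
      case False
      then have "m = (m - 1) + 1" "m - 1 \<ge> 1" using m(1) by auto
      then show ?thesis using m g_Suc[of "m - 1" t] earring_loop_in_set[of "m - 1" t] by simp
    qed
  qed
  moreover have "continuous_on earring_set g"
    unfolding g_def
  proof (rule continuous_on_earring_scale)
    fix k :: nat assume "k \<ge> 1"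
    then consider "k = 1" | "real k \<ge> 2" by linarith
    then show "\<bar>a (real k)\<bar> \<le> 2"
      by cases (simp_all add: a_def divide_simps)
  qed
  ultimately show "continuous_map earring earring g"
    by (auto simp: earring_def continuous_map_in_subtopology)
qed

section \<open>Winding around a single circle\<close>

text \<open>Collapses every circle but the \<open>m\<close>-th to the origin, then reflects and
  rescales the \<open>m\<close>-th onto the complex unit circle, with the origin going to 1.\<close>

definition earring_degree_map :: "nat \<Rightarrow> real \<times> real \<Rightarrow> complex" where
  "earring_degree_map m z =
     (let w = (if earring_index z = real m then 1 else 0) *\<^sub>R z
      in Complex (1 - real m * fst w) (real m * snd w))"

lemma earring_degree_map_loop:
  assumes "m \<ge> 1" "k \<ge> 1"
  shows "earring_degree_map m (earring_loop k t) = (if k = m then cis (2 * pi * t) else 1)"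
  unfolding earring_degree_map_def Let_def
    earring_scale_loop[OF assms(2), of "\<lambda>i. if i = real m then 1 else 0" t]
  using assms by (auto simp: earring_loop_def complex_eq_iff)

lemma continuous_map_earring_degree_map:
  assumes m: "m \<ge> 1"
  shows "continuous_map earring (top_of_set (- {0})) (earring_degree_map m)"
proof -
  define r where "r z = (if earring_index z = real m then 1 else 0) *\<^sub>R z" for z
  have "continuous_on earring_set r"
    unfolding r_def by (rule continuous_on_earring_scale[where B = 1]) simp
  then have "continuous_on earring_set (\<lambda>z. Complex (1 - real m * fst (r z)) (real m * snd (r z)))"
    unfolding Complex_eq by (intro continuous_intros)
  then have "continuous_on earring_set (earring_degree_map m)"
    unfolding earring_degree_map_def Let_def r_def .
  moreover have "earring_degree_map m z \<noteq> 0" if "z \<in> earring_set" for z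
    using that by (rule earring_setE) (simp add: earring_degree_map_loop[OF m])
  ultimately show ?thesis
    by (auto simp: earring_def continuous_map_in_subtopology)
qed

text \<open>At \<open>t = 0\<close> the junk value \<open>1 / 0 = 0\<close> selects the index 0, whose loop is constantly 0.\<close>

definition earring_word :: "nat set \<Rightarrow> real \<Rightarrow> real \<times> real" where
  "earring_word S t =
     (if nat \<lfloor>1 / t\<rfloor> \<in> S then earring_loop (nat \<lfloor>1 / t\<rfloor>) (1 / t) else 0)"

lemma earring_loop_0 [simp]: "earring_loop 0 t = 0"
  by (simp add: earring_loop_def zero_prod_def)

text \<open>The second bound says that the circle visited at time \<open>t\<close> has radius at
  most \<open>2 * t\<close>, which gives continuity of \<open>earring_word\<close> at 0.\<close>

lemma nat_floor_inverse:
  fixes t :: real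
  assumes "0 < t" "t \<le> 1"
  shows "nat \<lfloor>1 / t\<rfloor> \<ge> 1" "1 / real (nat \<lfloor>1 / t\<rfloor>) \<le> 2 * t"
proof -
  have "1 \<le> 1 / t" using assms by simp
  then have 1: "1 \<le> \<lfloor>1 / t\<rfloor>" by (simp add: le_floor_iff)
  then show "nat \<lfloor>1 / t\<rfloor> \<ge> 1" by linarith
  have "1 / t < of_int \<lfloor>1 / t\<rfloor> + 1" by linarith
  then have "1 / t \<le> 2 * of_int \<lfloor>1 / t\<rfloor>" using 1 by linarith
  then show "1 / real (nat \<lfloor>1 / t\<rfloor>) \<le> 2 * t"
    using 1 assms(1) by (simp add: field_simps)
qed

text \<open>At \<open>t = 0\<close> the circles shrink. Where \<open>1 / t\<close> is an integer the
  index may jump, but the unit loop \<open>v\<close> vanishes there and the factors are bounded.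
  Elsewhere the floor is locally constant.\<close>

lemma continuous_on_earring_word: "continuous_on {0..1} (earring_word S)"
  unfolding continuous_on_def
proof
  fix t :: real assume t: "t \<in> {0..1}"
  define a where "a j = (if nat j \<in> S then 1 / real (nat j) else 0)" for j :: int
  define v where "v s = (1 - cos (2 * pi * s), sin (2 * pi * s))" for s :: real
  have word: "earring_word S u = a \<lfloor>1 / u\<rfloor> *\<^sub>R v (1 / u)" for u
    by (simp add: earring_word_def earring_loop_def a_def v_def zero_prod_def)
  show "(earring_word S \<longlongrightarrow> earring_word S t) (at t within {0..1})"
  proof (cases "t = 0")
    case True
    have "norm (earring_word S u) \<le> 4 * u" if u: "u \<in> {0..1}" for u
    proof (cases "u = 0")
      case False
      then have "0 < u" "u \<le> 1" using u by auto
      have "norm (earring_word S u) \<le> 2 * (1 / real (nat \<lfloor>1 / u\<rfloor>))"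
        using norm_earring_loop_le by (simp add: earring_word_def)
      also have "\<dots> \<le> 2 * (2 * u)"
        using nat_floor_inverse(2)[OF \<open>0 < u\<close> \<open>u \<le> 1\<close>] by simp
      finally show ?thesis by simp
    qed (simp add: earring_word_def)
    then have "eventually (\<lambda>u. norm (earring_word S u) \<le> 4 * u) (at 0 within {0..1})"
      by (simp add: eventually_at_filter)
    moreover have "((\<lambda>u::real. 4 * u) \<longlongrightarrow> 0) (at 0 within {0..1})"
      by (intro tendsto_mult_right_zero tendsto_ident_at)
    ultimately have "(earring_word S \<longlongrightarrow> 0) (at 0 within {0..1})"
      by (rule Lim_null_comparison)
    then show ?thesis by (simp add: True earring_word_def)
  next
    case False
    have inv: "((\<lambda>u. 1 / u) \<longlongrightarrow> 1 / t) (at t within {0..1})"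
      by (intro tendsto_intros) (use False in auto)
    then have v: "((\<lambda>u. v (1 / u)) \<longlongrightarrow> v (1 / t)) (at t within {0..1})"
      unfolding v_def by (intro tendsto_intros) (use False in auto)
    show ?thesis
    proof (cases "1 / t \<in> \<int>")
      case True
      then obtain n where n: "1 / t = of_int n" by (rule Ints_cases)
      have v0: "v (1 / t) = 0" unfolding n v_def by (simp add: zero_prod_def)
      have "1 / real k \<le> 1" for k by (cases k) (simp_all add: divide_simps)
      then have "\<bar>a j\<bar> \<le> 1" for j by (simp add: a_def)
      then have "norm (earring_word S u) \<le> norm (v (1 / u))" for u
        unfolding word norm_scaleR by (intro mult_left_le_one_le) auto
      then have "(earring_word S \<longlongrightarrow> 0) (at t within {0..1})"
        by (intro Lim_null_comparison[OF always_eventually tendsto_norm_zero[OF v[unfolded v0]]]) simp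
      then show ?thesis by (simp add: word[of t] v0)
    next
      case False
      from eventually_floor_eq[OF inv False]
      have "eventually (\<lambda>u. a \<lfloor>1 / t\<rfloor> *\<^sub>R v (1 / u) = earring_word S u) (at t within {0..1})"
        by eventually_elim (simp add: word)
      moreover have "((\<lambda>u. a \<lfloor>1 / t\<rfloor> *\<^sub>R v (1 / u)) \<longlongrightarrow> earring_word S t) (at t within {0..1})"
        unfolding word by (intro tendsto_intros v)
      ultimately show ?thesis by (rule Lim_transform_eventually[rotated])
    qed
  qed
qed

lemma earring_word_loops_at: "earring_word S \<in> loops_at earring (0, 0)"
proof -
  have "earring_word S t \<in> earring_set" if t: "t \<in> {0..1}" for t
  proof (cases "t = 0 \<or> nat \<lfloor>1 / t\<rfloor> \<notin> S")
    case True
    then have "earring_word S t = (0, 0)" by (auto simp: earring_word_def zero_prod_def)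
    then show ?thesis using zero_in_earring by (simp add: topspace_earring)
  next
    case False
    then show ?thesis
      using t nat_floor_inverse(1)[of t] by (auto simp: earring_word_def intro: earring_loop_in_set)
  qed
  then have "pathin earring (earring_word S)"
    unfolding pathin_def earring_def continuous_map_in_subtopology
    using continuous_on_earring_word by auto
  then show ?thesis
    by (simp add: loops_at_def earring_word_def earring_loop_def zero_prod_def)
qed

text \<open>The angle is \<open>1 / t\<close> clamped to the range from \<open>m\<close> to
  \<open>m + 1\<close>: outside the time span of circle \<open>m\<close> it is an integer, where
  \<open>cis\<close> gives 1. Taking \<open>max\<close> inside the denominator imposes the upper
  clamp and avoids dividing by 0.\<close>

lemma earring_degree_map_word:
  assumes m: "m \<ge> 1" and t: "t \<in> {0..1}"
  shows "earring_degree_map m (earring_word S t) =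
    (if m \<in> S then cis (2 * pi * max (real m) (1 / max t (1 / (real m + 1)))) else 1)"
proof -
  have int: "cis (2 * pi * real n) = 1" for n
    using cis_multiple_2pi[of "real n"] by (simp add: mult.commute)
  have zero: "earring_degree_map m 0 = 1"
    using earring_degree_map_loop[OF m, of 1 0] by (simp add: earring_loop_def zero_prod_def)
  define k where "k = nat \<lfloor>1 / t\<rfloor>"
  have "earring_degree_map m (earring_word S t) = (if m \<in> S \<and> k = m then cis (2 * pi * (1 / t)) else 1)"
  proof (cases "t = 0")
    case True
    then show ?thesis using m by (auto simp: earring_word_def k_def zero)
  next
    case False
    then have "k \<ge> 1" unfolding k_def using t by (intro nat_floor_inverse(1)) auto
    then show ?thesis
      using earring_degree_map_loop[OF m, of k "1 / t"] by (auto simp: earring_word_def k_def zero)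
  qed
  moreover have "(if k = m then cis (2 * pi * (1 / t)) else 1)
      = cis (2 * pi * max (real m) (1 / max t (1 / (real m + 1))))"
  proof -
    \<comment> \<open>Before, during and after the visit to circle \<open>m\<close>; the half-open
      middle interval is exactly where the floor of \<open>1 / t\<close> equals
      \<open>m\<close>.\<close>
    consider "t \<le> 1 / (real m + 1)" | "1 / (real m + 1) < t" "t \<le> 1 / real m" | "1 / real m < t"
      by linarith
    then show ?thesis
    proof cases
      case 1
      have "k \<noteq> m"
      proof (cases "t = 0")
        case False
        then have "real m + 1 \<le> 1 / t" using 1 t by (simp add: field_simps)
        then have "int m + 1 \<le> \<lfloor>1 / t\<rfloor>" by (simp add: le_floor_iff)
        then show ?thesis unfolding k_def by linarith
      qed (use m in \<open>simp add: k_def\<close>)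
      moreover have "max (real m) (1 / max t (1 / (real m + 1))) = real (m + 1)"
        using 1 by (simp add: max_absorb2 max_absorb1)
      ultimately show ?thesis using int[of "m + 1"] by simp
    next
      case 2
      have "0 < 1 / (real m + 1)" by simp
      then have "0 < t" using 2 by linarith
      then have b: "real m \<le> 1 / t" "1 / t < real m + 1" using 2 m by (simp_all add: field_simps)
      then have "\<lfloor>1 / t\<rfloor> = int m" by (simp add: floor_eq_iff)
      then have "k = m" by (simp add: k_def)
      then show ?thesis using 2 b by (simp add: max_absorb1 max_absorb2)
    next
      case 3
      have "1 / (real m + 1) < 1 / real m" using m by (simp add: field_simps)
      then have le: "1 / (real m + 1) \<le> t" using 3 by linarith
      have "0 < 1 / real m" using m by simp
      then have "0 < t" using 3 by linarith
      then have lt: "1 / t < real m" using 3 m by (simp add: field_simps)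
      then have "\<lfloor>1 / t\<rfloor> < int m" by (simp add: floor_less_iff)
      then have "k \<noteq> m" using m by (simp add: k_def)
      then show ?thesis using le lt int[of m] by (simp add: max_absorb1)
    qed
  qed
  ultimately show ?thesis by auto
qed

text \<open>If \<open>m\<close> were missing from \<open>T\<close>, the second loop would have
  constant image in the punctured plane, with constant lift 0 through \<open>exp\<close>. The lift
  of the first runs from 0 to \<open>- 2 * pi * \<i>\<close>, contradicting monodromy.\<close>

lemma earring_word_homotopic_imp_subset:
  assumes hom: "path_homotopic earring (earring_word S) (earring_word T)" and m: "m \<ge> 1" "m \<in> S"
  shows "m \<in> T"
proof (rule ccontr)
  assume "m \<notin> T"
  let ?\<phi> = "earring_degree_map m"
  \<comment> \<open>The clamped \<open>1 / t\<close> decreases from \<open>m + 1\<close> to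
    \<open>m\<close>; subtracting \<open>m + 1\<close> makes the lift start at 0 and gives total
    change \<open>- 2 * pi\<close>.\<close>
  define \<theta> where "\<theta> t = 2 * pi * (max (real m) (1 / max t (1 / (real m + 1))) - real (m + 1))" for t
  have hp: "homotopic_paths (- {0}) (?\<phi> \<circ> earring_word S) (?\<phi> \<circ> earring_word T)"
    using path_homotopic_compose[OF hom continuous_map_earring_degree_map[OF m(1)]]
    by (simp add: path_homotopic_homotopic_paths)
  have "pathfinish (\<lambda>t. \<i> * of_real (\<theta> t)) = pathfinish (\<lambda>t. 0)"
  proof (rule covering_space_monodromy[OF covering_space_exp_punctured_plane _ _ _ _ hp])
    have "max t (1 / (real m + 1)) > 0" for t
      by (simp add: less_max_iff_disj)
    then show "path (\<lambda>t. \<i> * of_real (\<theta> t))"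
      unfolding path_def \<theta>_def by (intro continuous_intros) (simp add: less_imp_neq[symmetric])
    show "exp (\<i> * of_real (\<theta> t)) = (?\<phi> \<circ> earring_word S) t" if "t \<in> {0..1}" for t
    proof -
      have "cis (2 * pi * real (m + 1)) = 1"
        using cis_multiple_2pi[of "real (m + 1)"] by (simp only: mult.commute Ints_of_nat)
      then have "cis (\<theta> t) = cis (2 * pi * max (real m) (1 / max t (1 / (real m + 1))))"
        unfolding \<theta>_def right_diff_distrib cis_divide[symmetric] by simp
      then show ?thesis
        using earring_degree_map_word[OF m(1) that] m(2) by (simp add: cis_conv_exp)
    qed
    show "exp 0 = (?\<phi> \<circ> earring_word T) t" if "t \<in> {0..1}" for t
      using earring_degree_map_word[OF m(1) that] \<open>m \<notin> T\<close> by simp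
    show "pathstart (\<lambda>t. \<i> * of_real (\<theta> t)) = pathstart (\<lambda>t. 0)"
      by (simp add: pathstart_def \<theta>_def)
  qed (use homotopic_paths_imp_path[OF hp] homotopic_paths_imp_subset[OF hp] in \<open>auto simp: path_def\<close>)
  moreover have "\<theta> 1 = - 2 * pi"
    using m(1) by (simp add: \<theta>_def max_absorb1 algebra_simps)
  ultimately show False by (simp add: pathfinish_def)
qed

section \<open>Uncountability and the final assembly\<close>

lemma uncountable_UNIV_nat_set: "uncountable (UNIV :: nat set set)"
  using Cantors_theorem[of "UNIV :: nat set"] by (auto simp: uncountable_def)

theorem lemma2p3:
  shows "subgroup (induced_map earring_torus earring_incl ` carrier (fundamental_group earring (0, 0)))
           (fundamental_group earring_torus (earring_incl (0, 0))
              \<lparr>carrier := spanier_group earring_torus (earring_incl (0, 0))\<rparr>)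
       \<and> uncountable (spanier_group earring_torus (earring_incl (0, 0)))"
proof
  let ?G = "fundamental_group earring_torus (earring_incl (0, 0))"
  let ?E = "fundamental_group earring (0, 0)"
  let ?S = "spanier_group earring_torus (earring_incl (0, 0))"
  have incl: "earring_incl = (\<lambda>x. torus_proj earring earring_shift (x, 0))"
    by (rule ext) (simp add: earring_incl_def)
  have cont: "continuous_map earring earring_torus earring_incl"
    unfolding incl earring_torus_def by (rule continuous_map_torus_incl)
  have top: "earring_incl (0, 0) \<in> topspace earring_torus"
    using continuous_map_image_subset_topspace[OF cont] zero_in_earring by blast
  have in_S: "path_class earring_torus (earring_incl \<circ> p) \<in> ?S"
    if "p \<in> loops_at earring (0, 0)" for p
    unfolding incl earring_torus_def
    by (rule path_class_torus_in_spanier_group[OF continuous_map_earring_shift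
          zero_in_earring earring_shift_zero that earring_shift_shrinks])
  interpret group_hom ?E ?G "induced_map earring_torus earring_incl"
    using induced_map_hom[OF cont] group_fundamental_group[OF zero_in_earring]
      group_fundamental_group[OF top]
    by (simp add: group_hom_def group_hom_axioms_def)
  have "induced_map earring_torus earring_incl ` carrier ?E \<subseteq> ?S"
  proof
    fix a assume "a \<in> induced_map earring_torus earring_incl ` carrier ?E"
    then obtain p where p: "p \<in> loops_at earring (0, 0)"
      "a = induced_map earring_torus earring_incl (path_class earring p)"
      by (auto simp: carrier_fundamental_group)
    then have "a = path_class earring_torus (earring_incl \<circ> p)"
      using induced_map_path_class[OF cont] by (simp add: loops_at_def)
    then show "a \<in> ?S" using in_S[OF p(1)] by simp
  qed
  then show "subgroup (induced_map earring_torus earring_incl ` carrier ?E) (?G\<lparr>carrier := ?S\<rparr>)"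
    by (rule H.subgroup_incl[OF img_is_subgroup subgroup_spanier_group[OF top]])
  \<comment> \<open>\<open>Suc\<close> avoids index 0, whose loop is constant and could not be
    detected.\<close>
  define w where "w A = path_class earring_torus (earring_incl \<circ> earring_word (Suc ` A))" for A
  obtain g where g: "continuous_map earring earring g"
    "\<And>z. z \<in> topspace earring \<Longrightarrow> g (earring_shift z) = z"
    using earring_shift_left_inverse by blast
  \<comment> \<open>Used in both directions, this inclusion yields injectivity of
    \<open>w\<close>.\<close>
  have sub: "A \<subseteq> B" if "w A = w B" for A B
  proof
    fix n assume "n \<in> A"
    have path: "pathin earring (earring_word C)" for C
      using earring_word_loops_at[of C] by (simp add: loops_at_def)
    have "path_homotopic earring_torus (earring_incl \<circ> earring_word (Suc ` A))
        (earring_incl \<circ> earring_word (Suc ` B))"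
      using that path_class_eq_iff[OF pathin_compose[OF path cont]] by (simp add: w_def)
    then have "path_homotopic earring (earring_word (Suc ` A)) (earring_word (Suc ` B))"
      unfolding incl earring_torus_def
      by (rule path_homotopic_mapping_torusD[OF continuous_map_earring_shift g(1) _ path path, rotated])
        (erule g(2))
    from earring_word_homotopic_imp_subset[OF this, of "Suc n"] \<open>n \<in> A\<close>
    show "n \<in> B" by auto
  qed
  have "inj w"
    by (rule injI) (use sub in blast)
  then have "uncountable (range w)"
    using uncountable_UNIV_nat_set countable_image_inj_on by blast
  moreover have "range w \<subseteq> ?S"
    using in_S[OF earring_word_loops_at] by (auto simp: w_def)
  ultimately show "uncountable ?S"
    using countable_subset by blast
qed

end
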